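(* Let $A_j$ ($j=0,\dots,\kappa-1$) be $n\times n$ matrices, $B$ an $n\times r$ matrix, $U\subseteq\mathbb{R}^r$ a convex set, and $F(x,v_1,\dots,v_{\kappa-1})=A_0x+\sum_{j=1}^{\kappa-1}A_jv_j+BU$. Let $\varphi:(\mathbb{R}^n)^\kappa\to\mathbb{R}^1$ be a continuous proper convex function and $Q_j\subseteq\mathbb{R}^n$, $j=0,\dots,\kappa-1$, convex sets. Consider the primary semilinear problem $(P_{SL})$: minimize $\varphi\big(x(1),x'(1),\dots,x^{(\kappa-1)}(1)\big)$ subject to $x^{(\kappa)}(t)\in F\big(x(t),\dots,x^{(\kappa-1)}(t)\big)$ a.e. $t\in[0,1]$, $x^{(j)}(0)\in Q_j$, $j=0,\dots,\kappa-1$. For a function $x^*$ put $$\eta_j^*[x^*](t)=A_{\kappa-j}^*x^*(t)-A_{\kappa-j+1}^*x^{*\prime}(t)+\cdots+(-1)^{j-1}A_{\kappa-1}^*x^{*(j-1)}(t),\quad j=1,\dots,\kappa-1,\qquad \eta_0^*[x^*]\equiv0.$$ The dual problem $(P_{SL}^* )$ is: maximize $$-\varphi^*\Big((-1)^\kappa x^{*(\kappa-1)}(1)+\eta_{\kappa-1}^*[x^*](1),\ (-1)^{\kappa-1}x^{*(\kappa-2)}(1)+\eta_{\kappa-2}^*[x^*](1),\dots,x^{*\prime}(1)+\eta_1^*[x^*](1),\ -x^*(1)\Big)$$ $$-\int_0^1W_U\big(B^*x^*(t)\big)dt-\sum_{j=0}^{\kappa-1}W_{Q_{\kappa-j-1}}\Big((-1)^jx^{*(j)}(0)-\eta_j^*[x^*](0)\Big)$$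 over solutions $x^*(\cdot)$ of the Euler–Lagrange equation $$(-1)^\kappa\frac{d^\kappa x^*(t)}{dt^\kappa}=A_0^*x^*(t)-A_1^*x^{*\prime}(t)+\cdots+(-1)^{\kappa-1}A_{\kappa-1}^*x^{*(\kappa-1)}(t)\quad\text{a.e. }t\in[0,1].\tag{EL}$$ Let $\tilde x(\cdot)$ be an optimal solution of $(P_{SL})$, corresponding to a control $\tilde u(t)\in U$, for which the sufficient optimality conditions hold, i.e. there exist $x^*,\eta_1^*,\dots,\eta_{\kappa-1}^*$ satisfying (i) $\Big((-1)^\kappa x^{*(\kappa)}(t)+\eta_{\kappa-1}^{*\prime}(t),\ \eta_{\kappa-1}^*(t)+\eta_{\kappa-2}^{*\prime}(t),\dots,\eta_2^*(t)+\eta_1^{*\prime}(t),\ \eta_1^*(t)\Big)\in F^*\big(x^*(t);(\tilde x(t),\dots,\tilde x^{(\kappa)}(t))\big)$ a.e. $t\in[0,1]$; (ii) $(-1)^{j+1}x^{*(j)}(0)+\eta_j^*(0)\in K^*_{Q_{\kappa-j-1}}\big(\tilde x^{(\kappa-j-1)}(0)\big)$ for $j=1,\dots,\kappa-1$, and $-x^*(0)\in K^*_{Q_{\kappa-1}}\big(\tilde x^{(\kappa-1)}(0)\big)$; (iii) $\Big((-1)^\kappa x^{*(\kappa-1)}(1)+\eta_{\kappa-1}^*(1),\dots,x^{*\prime}(1)+\eta_1^*(1),\ -x^*(1)\Big)\in\partial\varphi\big(\tilde x(1),\dots,\tilde x^{(\kappa-1)}(1)\big)$; (iv) $\tilde x^{(\kappa)}(t)\in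 F_A\big(\tilde x(t),\dots,\tilde x^{(\kappa-1)}(t);x^*(t)\big)$ a.e. $t\in[0,1]$. Then $\tilde x^*(t)$, $t\in[0,1]$, is an optimal solution of $(P_{SL}^* )$ if and only if $\tilde x^*$ satisfies (EL), conditions (ii) and (iii) with $x^*=\tilde x^*$ and $\eta_j^*=\eta_j^*[\tilde x^*]$, and the maximum principle $\langle B\tilde u(t),\tilde x^*(t)\rangle=\sup_{u\in U}\langle Bu,\tilde x^*(t)\rangle$ for a.e. $t\in[0,1]$. In addition, the optimal values of $(P_{SL})$ and $(P_{SL}^* )$ are equal.
   Context: $\kappa\ge1$ is a fixed natural number. Feasible trajectories are functions $x:[0,1]\to\mathbb{R}^n$ absolutely continuous together with their derivatives up to order $\kappa-1$, with $x^{(\kappa)}\in L_1^n([0,1])$, satisfying the constraints. Adjoint functions $x^*$ have this same regularity, and each $\eta_j^*$ in (i)–(iv) is absolutely continuous with derivative in $L_1^n([0,1])$; by convention $\eta_0^*\equiv0$ (for $\kappa=1$ the tuples are just $-x^{*\prime}(t)$ in (i) and $-x^*(1)$ in (iii) and in $\varphi^*$). The trajectory $\tilde x$ corresponds to $\tilde u(t)\in U$ if $\tilde x^{(\kappa)}(t)=A_0\tilde x(t)+\sum_{j=1}^{\kappa-1}A_j\tilde x^{(j)}(t)+B\tilde u(t)$ a.e. $A_j^*,B^*$ are transposes. For a convex set $S$ and $z\in S$, $K_S(z)=\{\lambda(y-z):y\in S,\lambda>0\}$ and $K_S^*(z)=\{z^*:\langle\bar z,z^*\rangle\ge0\ \forall\bar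 z\in K_S(z)\}$. With $\operatorname{gph}F=\{(x,v_1,\dots,v_{\kappa-1},v):v\in F(x,v_1,\dots,v_{\kappa-1})\}$, the locally adjoint mapping at $z\in\operatorname{gph}F$ is $F^*(v^*;z)=\{(x^*,v_1^*,\dots,v_{\kappa-1}^* ):(x^*,v_1^*,\dots,v_{\kappa-1}^*,-v^* )\in K^*_{\operatorname{gph}F}(z)\}$. The argmaximum set is $F_A(x,v_1,\dots,v_{\kappa-1};v^* )=\{v\in F(x,v_1,\dots,v_{\kappa-1}):\langle v,v^*\rangle=\sup_{w\in F(x,v_1,\dots,v_{\kappa-1})}\langle w,v^*\rangle\}$. $W_Q(y^* )=\sup_{y\in Q}\langle y,y^*\rangle$ is the support function, $\varphi^*$ the convex conjugate and $\partial\varphi$ the convex subdifferential of $\varphi$. *)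

theory Defs
  imports "HOL-Analysis.Analysis"
begin

section \<open>Convex analysis\<close>

definition cone_at :: "'a::real_inner set \<Rightarrow> 'a \<Rightarrow> 'a set" where
  "cone_at S z = {l *\<^sub>R (y - z) | l y. y \<in> S \<and> l > 0}"

definition dual_cone_at :: "'a::real_inner set \<Rightarrow> 'a \<Rightarrow> 'a set" where
  "dual_cone_at S z = {zs. \<forall>w \<in> cone_at S z. w \<bullet> zs \<ge> 0}"

definition gph :: "('a \<Rightarrow> 'b set) \<Rightarrow> ('a \<times> 'b) set" where
  "gph F = {(z, v). v \<in> F z}"

definition locally_adjoint ::
    "('a::real_inner \<Rightarrow> 'b::real_inner set) \<Rightarrow> 'b \<Rightarrow> 'a \<times> 'b \<Rightarrow> 'a set" where
  "locally_adjoint F vs zv = {zs. (zs, - vs) \<in> dual_cone_at (gph F) zv}"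

definition argmax_set :: "('a \<Rightarrow> 'b::real_inner set) \<Rightarrow> 'a \<Rightarrow> 'b \<Rightarrow> 'b set" where
  "argmax_set F z vs = {v \<in> F z. ereal (v \<bullet> vs) = (SUP w \<in> F z. ereal (w \<bullet> vs))}"

definition support_fun :: "'a::real_inner set \<Rightarrow> 'a \<Rightarrow> ereal" where
  "support_fun S ys = (SUP y \<in> S. ereal (y \<bullet> ys))"

text \<open>
  The functions to which the next two notions are applied are finite-valued, hence
  automatically proper; the conjugate may still take the value \<open>\<infinity>\<close>.
\<close>

definition conjugate_fun :: "('a::real_inner \<Rightarrow> real) \<Rightarrow> 'a \<Rightarrow> ereal" where
  "conjugate_fun f ys = (SUP y. ereal (y \<bullet> ys - f y))"

definition subdifferential :: "('a::real_inner \<Rightarrow> real) \<Rightarrow> 'a \<Rightarrow> 'a set" where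
  "subdifferential f z = {ys. \<forall>y. f y - f z \<ge> (y - z) \<bullet> ys}"

section \<open>Trajectories on the unit interval\<close>

text \<open>
  Absolute continuity of a function of a real variable (the library constant
  \<open>absolutely_continuous\<close> is about measures).  The elements of a division are finitely many
  compact nondegenerate or one-point intervals with pairwise disjoint interiors.
\<close>

definition abs_continuous_on :: "real set \<Rightarrow> (real \<Rightarrow> 'a::real_normed_vector) \<Rightarrow> bool" where
  "abs_continuous_on S f \<longleftrightarrow>
     (\<forall>\<epsilon>>0. \<exists>\<delta>>0. \<forall>d. d division_of \<Union>d \<and> \<Union>d \<subseteq> S \<and> (\<Sum>k\<in>d. Sup k - Inf k) < \<delta>
        \<longrightarrow> (\<Sum>k\<in>d. norm (f (Sup k) - f (Inf k))) < \<epsilon>)"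

text \<open>The derivative of order \<open>j\<close> on \<open>[0,1]\<close>, one-sided at the end points.\<close>

definition D :: "nat \<Rightarrow> (real \<Rightarrow> 'a::real_normed_vector) \<Rightarrow> real \<Rightarrow> 'a" where
  "D j f = ((\<lambda>g t. vector_derivative g (at t within {0..1})) ^^ j) f"

text \<open>
  \<open>f\<close> is absolutely continuous on \<open>[0,1]\<close> together with its derivatives up to order \<open>m - 1\<close>,
  and its derivative of order \<open>m\<close> (which exists only almost everywhere) is in \<open>L\<^sub>1\<close>.
  The two differentiability clauses exclude the unspecified values of \<open>vector_derivative\<close>.
\<close>

definition regular :: "nat \<Rightarrow> (real \<Rightarrow> 'a::euclidean_space) \<Rightarrow> bool" where
  "regular m f \<longleftrightarrow>
     (\<forall>j<m. abs_continuous_on {0..1} (D j f)) \<and>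
     (\<forall>j. j + 1 < m \<longrightarrow> (\<forall>t\<in>{0..1}. D j f differentiable (at t within {0..1}))) \<and>
     (AE t in lebesgue_on {0..1}. D (m - 1) f differentiable (at t within {0..1})) \<and>
     D m f absolutely_integrable_on {0..1}"

text \<open>
  The integral of an extended-real function as the difference of the integrals of its positive
  and negative parts (\<open>e2ennreal\<close> sends negative numbers to \<open>0\<close>).
\<close>

definition ereal_integral :: "'a measure \<Rightarrow> ('a \<Rightarrow> ereal) \<Rightarrow> ereal" where
  "ereal_integral M f =
     enn2ereal (\<integral>\<^sup>+ t. e2ennreal (f t) \<partial>M) - enn2ereal (\<integral>\<^sup>+ t. e2ennreal (- f t) \<partial>M)"

section \<open>The primal problem\<close>

text \<open>
  Throughout, \<open>(\<real>\<^sup>n)\<^sup>\<kappa>\<close> is the type \<open>real^'n^'k\<close>, where \<open>\<iota>\<close> is a bijection from \<open>'k\<close> onto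
  \<open>{0,\<dots>,\<kappa>-1}\<close> that numbers the components; \<open>pack \<iota> c\<close> is the tuple \<open>(c\<^sub>0,\<dots>,c\<^sub>\<kappa>\<^sub>-\<^sub>1)\<close>.
\<close>

definition pack :: "('k \<Rightarrow> nat) \<Rightarrow> (nat \<Rightarrow> real^'n) \<Rightarrow> real^'n^'k" where
  "pack \<iota> c = (\<chi> i. c (\<iota> i))"

definition semilinear ::
    "('k::finite \<Rightarrow> nat) \<Rightarrow> (nat \<Rightarrow> real^'n^'n) \<Rightarrow> real^'r^'n \<Rightarrow> (real^'r) set
      \<Rightarrow> real^'n^'k \<Rightarrow> (real^'n) set" where
  "semilinear \<iota> A B U z = {(\<Sum>i\<in>UNIV. A (\<iota> i) *v (z $ i)) + B *v u | u. u \<in> U}"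

definition primal_feasible ::
    "nat \<Rightarrow> ('k::finite \<Rightarrow> nat) \<Rightarrow> (real^'n^'k \<Rightarrow> (real^'n) set) \<Rightarrow> (nat \<Rightarrow> (real^'n) set)
      \<Rightarrow> (real \<Rightarrow> real^'n) set" where
  "primal_feasible \<kappa> \<iota> F Q = {x. regular \<kappa> x \<and>
     (AE t in lebesgue_on {0..1}. D \<kappa> x t \<in> F (pack \<iota> (\<lambda>j. D j x t))) \<and>
     (\<forall>j<\<kappa>. D j x 0 \<in> Q j)}"

definition primal_objective ::
    "('k::finite \<Rightarrow> nat) \<Rightarrow> (real^'n^'k \<Rightarrow> real) \<Rightarrow> (real \<Rightarrow> real^'n) \<Rightarrow> real" where
  "primal_objective \<iota> \<phi> x = \<phi> (pack \<iota> (\<lambda>j. D j x 1))"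

definition primal_optimal ::
    "nat \<Rightarrow> ('k::finite \<Rightarrow> nat) \<Rightarrow> (real^'n^'k \<Rightarrow> real) \<Rightarrow> (real^'n^'k \<Rightarrow> (real^'n) set)
      \<Rightarrow> (nat \<Rightarrow> (real^'n) set) \<Rightarrow> (real \<Rightarrow> real^'n) \<Rightarrow> bool" where
  "primal_optimal \<kappa> \<iota> \<phi> F Q x \<longleftrightarrow> x \<in> primal_feasible \<kappa> \<iota> F Q \<and>
     (\<forall>y \<in> primal_feasible \<kappa> \<iota> F Q. primal_objective \<iota> \<phi> x \<le> primal_objective \<iota> \<phi> y)"

definition primal_value ::
    "nat \<Rightarrow> ('k::finite \<Rightarrow> nat) \<Rightarrow> (real^'n^'k \<Rightarrow> real) \<Rightarrow> (real^'n^'k \<Rightarrow> (real^'n) set)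
      \<Rightarrow> (nat \<Rightarrow> (real^'n) set) \<Rightarrow> ereal" where
  "primal_value \<kappa> \<iota> \<phi> F Q =
     (INF x \<in> primal_feasible \<kappa> \<iota> F Q. ereal (primal_objective \<iota> \<phi> x))"

definition corresponds_to_control ::
    "nat \<Rightarrow> (nat \<Rightarrow> real^'n^'n) \<Rightarrow> real^'r^'n \<Rightarrow> (real^'r) set
      \<Rightarrow> (real \<Rightarrow> real^'n) \<Rightarrow> (real \<Rightarrow> real^'r) \<Rightarrow> bool" where
  "corresponds_to_control \<kappa> A B U x u \<longleftrightarrow>
     (\<forall>t\<in>{0..1}. u t \<in> U) \<and>
     (AE t in lebesgue_on {0..1}. D \<kappa> x t = (\<Sum>j<\<kappa>. A j *v D j x t) + B *v u t)"

section \<open>Optimality conditions\<close>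

text \<open>
  The adjoint functions are \<open>\<eta> 1, \<dots>, \<eta> (\<kappa> - 1)\<close>; the conditions are only used with \<open>\<eta> 0\<close>
  identically zero, which makes the last components below \<open>\<eta>\<^sub>1(t)\<close> (for \<open>\<kappa> > 1\<close>) and
  \<open>-x\<^sup>*(1)\<close>, respectively.
\<close>

definition adjoint_inclusion ::
    "nat \<Rightarrow> ('k::finite \<Rightarrow> nat) \<Rightarrow> (real^'n^'k \<Rightarrow> (real^'n) set)
      \<Rightarrow> (real \<Rightarrow> real^'n) \<Rightarrow> (real \<Rightarrow> real^'n) \<Rightarrow> (nat \<Rightarrow> real \<Rightarrow> real^'n) \<Rightarrow> bool" where
  "adjoint_inclusion \<kappa> \<iota> F x xs \<eta> \<longleftrightarrow>
     (AE t in lebesgue_on {0..1}.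
        pack \<iota> (\<lambda>j. (if j = 0 then (-1) ^ \<kappa> *\<^sub>R D \<kappa> xs t else \<eta> (\<kappa> - j) t)
                     + D 1 (\<eta> (\<kappa> - j - 1)) t)
        \<in> locally_adjoint F (xs t) (pack \<iota> (\<lambda>j. D j x t), D \<kappa> x t))"

definition initial_transversality ::
    "nat \<Rightarrow> (nat \<Rightarrow> (real^'n) set)
      \<Rightarrow> (real \<Rightarrow> real^'n) \<Rightarrow> (real \<Rightarrow> real^'n) \<Rightarrow> (nat \<Rightarrow> real \<Rightarrow> real^'n) \<Rightarrow> bool" where
  "initial_transversality \<kappa> Q x xs \<eta> \<longleftrightarrow>
     (\<forall>j\<in>{1..<\<kappa>}. (-1) ^ (j + 1) *\<^sub>R D j xs 0 + \<eta> j 0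
        \<in> dual_cone_at (Q (\<kappa> - j - 1)) (D (\<kappa> - j - 1) x 0)) \<and>
     - xs 0 \<in> dual_cone_at (Q (\<kappa> - 1)) (D (\<kappa> - 1) x 0)"

definition endpoint_tuple ::
    "nat \<Rightarrow> ('k::finite \<Rightarrow> nat) \<Rightarrow> (real \<Rightarrow> real^'n) \<Rightarrow> (nat \<Rightarrow> real \<Rightarrow> real^'n) \<Rightarrow> real^'n^'k" where
  "endpoint_tuple \<kappa> \<iota> xs \<eta> =
     pack \<iota> (\<lambda>i. (-1) ^ (\<kappa> - i) *\<^sub>R D (\<kappa> - 1 - i) xs 1 + \<eta> (\<kappa> - 1 - i) 1)"

definition final_transversality ::
    "nat \<Rightarrow> ('k::finite \<Rightarrow> nat) \<Rightarrow> (real^'n^'k \<Rightarrow> real)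
      \<Rightarrow> (real \<Rightarrow> real^'n) \<Rightarrow> (real \<Rightarrow> real^'n) \<Rightarrow> (nat \<Rightarrow> real \<Rightarrow> real^'n) \<Rightarrow> bool" where
  "final_transversality \<kappa> \<iota> \<phi> x xs \<eta> \<longleftrightarrow>
     endpoint_tuple \<kappa> \<iota> xs \<eta> \<in> subdifferential \<phi> (pack \<iota> (\<lambda>j. D j x 1))"

definition argmax_condition ::
    "nat \<Rightarrow> ('k::finite \<Rightarrow> nat) \<Rightarrow> (real^'n^'k \<Rightarrow> (real^'n) set)
      \<Rightarrow> (real \<Rightarrow> real^'n) \<Rightarrow> (real \<Rightarrow> real^'n) \<Rightarrow> bool" where
  "argmax_condition \<kappa> \<iota> F x xs \<longleftrightarrow>
     (AE t in lebesgue_on {0..1}. D \<kappa> x t \<in> argmax_set F (pack \<iota> (\<lambda>j. D j x t)) (xs t))"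

definition sufficient_conditions ::
    "nat \<Rightarrow> ('k::finite \<Rightarrow> nat) \<Rightarrow> (real^'n^'k \<Rightarrow> real) \<Rightarrow> (real^'n^'k \<Rightarrow> (real^'n) set)
      \<Rightarrow> (nat \<Rightarrow> (real^'n) set)
      \<Rightarrow> (real \<Rightarrow> real^'n) \<Rightarrow> (real \<Rightarrow> real^'n) \<Rightarrow> (nat \<Rightarrow> real \<Rightarrow> real^'n) \<Rightarrow> bool" where
  "sufficient_conditions \<kappa> \<iota> \<phi> F Q x xs \<eta> \<longleftrightarrow>
     regular \<kappa> xs \<and> (\<forall>j\<in>{1..<\<kappa>}. regular 1 (\<eta> j)) \<and> \<eta> 0 = (\<lambda>t. 0) \<and>
     adjoint_inclusion \<kappa> \<iota> F x xs \<eta> \<and>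
     initial_transversality \<kappa> Q x xs \<eta> \<and>
     final_transversality \<kappa> \<iota> \<phi> x xs \<eta> \<and>
     argmax_condition \<kappa> \<iota> F x xs"

section \<open>The dual problem\<close>

text \<open>The empty sum gives the convention that \<open>eta_of \<kappa> A xs 0\<close> vanishes identically.\<close>

definition eta_of ::
    "nat \<Rightarrow> (nat \<Rightarrow> real^'n^'n) \<Rightarrow> (real \<Rightarrow> real^'n) \<Rightarrow> nat \<Rightarrow> real \<Rightarrow> real^'n" where
  "eta_of \<kappa> A xs j t = (\<Sum>i<j. (-1) ^ i *\<^sub>R (transpose (A (\<kappa> - j + i)) *v D i xs t))"

definition euler_lagrange_solutions ::
    "nat \<Rightarrow> (nat \<Rightarrow> real^'n^'n) \<Rightarrow> (real \<Rightarrow> real^'n) set" where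
  "euler_lagrange_solutions \<kappa> A = {xs. regular \<kappa> xs \<and>
     (AE t in lebesgue_on {0..1}.
        (-1) ^ \<kappa> *\<^sub>R D \<kappa> xs t = (\<Sum>j<\<kappa>. (-1) ^ j *\<^sub>R (transpose (A j) *v D j xs t)))}"

definition dual_objective ::
    "nat \<Rightarrow> ('k::finite \<Rightarrow> nat) \<Rightarrow> (real^'n^'k \<Rightarrow> real) \<Rightarrow> (nat \<Rightarrow> real^'n^'n) \<Rightarrow> real^'r^'n
      \<Rightarrow> (real^'r) set \<Rightarrow> (nat \<Rightarrow> (real^'n) set) \<Rightarrow> (real \<Rightarrow> real^'n) \<Rightarrow> ereal" where
  "dual_objective \<kappa> \<iota> \<phi> A B U Q xs =
     - conjugate_fun \<phi> (endpoint_tuple \<kappa> \<iota> xs (eta_of \<kappa> A xs))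
     - ereal_integral (lebesgue_on {0..1}) (\<lambda>t. support_fun U (transpose B *v xs t))
     - (\<Sum>j<\<kappa>. support_fun (Q (\<kappa> - j - 1)) ((-1) ^ j *\<^sub>R D j xs 0 - eta_of \<kappa> A xs j 0))"

definition dual_optimal ::
    "nat \<Rightarrow> ('k::finite \<Rightarrow> nat) \<Rightarrow> (real^'n^'k \<Rightarrow> real) \<Rightarrow> (nat \<Rightarrow> real^'n^'n) \<Rightarrow> real^'r^'n
      \<Rightarrow> (real^'r) set \<Rightarrow> (nat \<Rightarrow> (real^'n) set) \<Rightarrow> (real \<Rightarrow> real^'n) \<Rightarrow> bool" where
  "dual_optimal \<kappa> \<iota> \<phi> A B U Q xs \<longleftrightarrow> xs \<in> euler_lagrange_solutions \<kappa> A \<and>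
     (\<forall>ys \<in> euler_lagrange_solutions \<kappa> A.
        dual_objective \<kappa> \<iota> \<phi> A B U Q ys \<le> dual_objective \<kappa> \<iota> \<phi> A B U Q xs)"

definition dual_value ::
    "nat \<Rightarrow> ('k::finite \<Rightarrow> nat) \<Rightarrow> (real^'n^'k \<Rightarrow> real) \<Rightarrow> (nat \<Rightarrow> real^'n^'n) \<Rightarrow> real^'r^'n
      \<Rightarrow> (real^'r) set \<Rightarrow> (nat \<Rightarrow> (real^'n) set) \<Rightarrow> ereal" where
  "dual_value \<kappa> \<iota> \<phi> A B U Q =
     (SUP xs \<in> euler_lagrange_solutions \<kappa> A. dual_objective \<kappa> \<iota> \<phi> A B U Q xs)"

end

theory Submission
  imports Defs
begin

text \<open>
  The theorem is weak duality together with the analysis of its equality case. Fix the optimal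
  trajectory \<open>x\<close> with control \<open>u\<close>, and let \<open>x\<^sup>*\<close> solve the Euler--Lagrange equation. Put
  \<open>p\<^sub>j = (-1)\<^sup>j\<^sup>+\<^sup>1 x\<^sup>*\<^sup>(\<^sup>j\<^sup>) + \<eta>\<^sub>j\<close> (the \<open>costate\<close>s). The final tuple of the dual problem consists of the
  \<open>p\<^sub>j(1)\<close>, and the arguments of the support functions of the initial sets are the \<open>-p\<^sub>j(0)\<close>. The
  costates satisfy \<open>p\<^sub>j' = A\<^sub>\<kappa>\<^sub>-\<^sub>1\<^sub>-\<^sub>j\<^sup>* x\<^sup>* - p\<^sub>j\<^sub>+\<^sub>1\<close> with \<open>p\<^sub>\<kappa> = 0\<close>, so that for
  \<open>H = \<Sum>j<\<kappa>. \<langle>x\<^sup>(\<^sup>\<kappa>\<^sup>-\<^sup>1\<^sup>-\<^sup>j\<^sup>), p\<^sub>j\<rangle>\<close> the derivative telescopes to \<open>-\<langle>B u, x\<^sup>*\<rangle>\<close>; this gives the integral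
  of \<open>\<langle>B u, x\<^sup>*\<rangle>\<close> over the unit interval as \<open>H(0) - H(1)\<close> (lemma \<open>lagrange_identity\<close>).

  Now every term of the dual objective is a supremum, and testing it with the data of \<open>x\<close> bounds it
  from below by \<open>H(1) - \<phi>\<close>, by the integral of \<open>\<langle>B u, x\<^sup>*\<rangle>\<close>, and by the summands of \<open>-H(0)\<close>. These
  add up to \<open>-\<phi>\<close>, hence the dual objective is at most the primal one, with equality exactly when every
  supremum is attained at the data of \<open>x\<close>: this is the subgradient condition at 1, the dual cone
  conditions at 0, and the maximum principle almost everywhere (lemma \<open>dual_objective_le_primal\<close>).

  It remains to see that equality does occur. The graph of the semilinear mapping contains all of
  the state space in its first component, so the locally adjoint inclusion is a linear system together
  with the maximum principle (lemma \<open>locally_adjoint_semilinear\<close>). The system determines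
  the adjoint functions as \<open>\<eta>\<^sub>j[x\<^sup>*]\<close> and leaves the Euler--Lagrange equation. Thus the \<open>x\<^sup>*\<close> of the sufficient
  conditions attains the primal value, the two values agree, and the dual optimal solutions are the
  solutions of the Euler--Lagrange equation in the equality case.

  The analytic ingredient is integration by parts for functions that are differentiable only almost
  everywhere, i.e. the fundamental theorem of calculus for absolutely continuous functions (lemma
  \<open>abs_continuous_has_integral\<close>).
\<close>

section \<open>Absolute continuity\<close>

text \<open>
  All closure properties of absolute continuity used here, sums, linear images and inner products,
  are instances of one estimate: increments of the new function are bounded by those of two
  absolutely continuous ones.
\<close>
lemma abs_continuous_on_dominated:
  assumes f: "abs_continuous_on S f" and g: "abs_continuous_on S g" and C: "C > 0"
    and dom: "\<And>s t. \<lbrakk>s \<in> S; t \<in> S\<rbrakk>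
      \<Longrightarrow> norm (h t - h s) \<le> C * (norm (f t - f s) + norm (g t - g s))"
  shows "abs_continuous_on S h"
  unfolding abs_continuous_on_def
proof (intro allI impI)
  fix e :: real assume "e > 0"
  then have e: "e / (2 * C) > 0" using C by simp
  obtain \<delta>1 where \<delta>1: "\<delta>1 > 0" "\<And>d. d division_of \<Union>d \<and> \<Union>d \<subseteq> S \<and> (\<Sum>k\<in>d. Sup k - Inf k) < \<delta>1
      \<Longrightarrow> (\<Sum>k\<in>d. norm (f (Sup k) - f (Inf k))) < e / (2 * C)"
    using f e unfolding abs_continuous_on_def by meson
  obtain \<delta>2 where \<delta>2: "\<delta>2 > 0" "\<And>d. d division_of \<Union>d \<and> \<Union>d \<subseteq> S \<and> (\<Sum>k\<in>d. Sup k - Inf k) < \<delta>2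
      \<Longrightarrow> (\<Sum>k\<in>d. norm (g (Sup k) - g (Inf k))) < e / (2 * C)"
    using g e unfolding abs_continuous_on_def by meson
  show "\<exists>\<delta>>0. \<forall>d. d division_of \<Union>d \<and> \<Union>d \<subseteq> S \<and> (\<Sum>k\<in>d. Sup k - Inf k) < \<delta>
      \<longrightarrow> (\<Sum>k\<in>d. norm (h (Sup k) - h (Inf k))) < e"
  proof (intro exI conjI allI impI; (elim conjE)?)
    show "min \<delta>1 \<delta>2 > 0" using \<delta>1 \<delta>2 by simp
  next
    fix d :: "real set set"
    assume d: "d division_of \<Union>d" "\<Union>d \<subseteq> S" and len: "(\<Sum>k\<in>d. Sup k - Inf k) < min \<delta>1 \<delta>2"
    have "(\<Sum>k\<in>d. norm (h (Sup k) - h (Inf k)))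
        \<le> (\<Sum>k\<in>d. C * (norm (f (Sup k) - f (Inf k)) + norm (g (Sup k) - g (Inf k))))"
    proof (rule sum_mono)
      fix k assume k: "k \<in> d"
      obtain u v where "k = {u..v}" "u \<le> v"
        using division_ofD(3,4)[OF d(1) k] by auto
      moreover have "k \<subseteq> S" using k d(2) by blast
      ultimately show "norm (h (Sup k) - h (Inf k))
          \<le> C * (norm (f (Sup k) - f (Inf k)) + norm (g (Sup k) - g (Inf k)))"
        using dom[of u v] by (simp add: subset_iff)
    qed
    also have "\<dots> = C * ((\<Sum>k\<in>d. norm (f (Sup k) - f (Inf k))) + (\<Sum>k\<in>d. norm (g (Sup k) - g (Inf k))))"
      by (simp add: sum.distrib sum_distrib_left distrib_left)
    also have "\<dots> < C * (e / (2 * C) + e / (2 * C))"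
      using \<delta>1(2)[of d] \<delta>2(2)[of d] d len C by (intro mult_strict_left_mono add_strict_mono) auto
    also have "\<dots> = e" using C by simp
    finally show "(\<Sum>k\<in>d. norm (h (Sup k) - h (Inf k))) < e" .
  qed
qed

lemma abs_continuous_on_imp_continuous_on:
  assumes ac: "abs_continuous_on {a..b} f"
  shows "continuous_on {a..b} f"
  unfolding continuous_on_iff
proof (intro ballI allI impI)
  fix x e :: real assume x: "x \<in> {a..b}" and "e > 0"
  then obtain \<delta> where \<delta>: "\<delta> > 0" "\<And>d. d division_of \<Union>d \<and> \<Union>d \<subseteq> {a..b} \<and> (\<Sum>k\<in>d. Sup k - Inf k) < \<delta>
      \<Longrightarrow> (\<Sum>k\<in>d. norm (f (Sup k) - f (Inf k))) < e"
    using ac unfolding abs_continuous_on_def by meson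
  have step: "norm (f v - f u) < e" if "u \<in> {a..b}" "v \<in> {a..b}" "u \<le> v" "v - u < \<delta>" for u v
  proof -
    have "{{u..v}} division_of \<Union>{{u..v}}"
      using division_of_self[of u v] that(3) by simp
    then show ?thesis using \<delta>(2)[of "{{u..v}}"] that by simp
  qed
  have "dist (f y) (f x) < e" if y: "y \<in> {a..b}" "dist y x < \<delta>" for y
    using step[of x y] step[of y x] x y by (cases "x \<le> y") (simp_all add: dist_norm norm_minus_commute)
  then show "\<exists>d>0. \<forall>y\<in>{a..b}. dist y x < d \<longrightarrow> dist (f y) (f x) < e" using \<delta>(1) by blast
qed

lemma abs_continuous_on_const: "abs_continuous_on S (\<lambda>t. c)"
  unfolding abs_continuous_on_def by (auto intro: exI[of _ 1])

lemma abs_continuous_on_bounded_linear: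
  assumes "bounded_linear L" and f: "abs_continuous_on S f"
  shows "abs_continuous_on S (\<lambda>t. L (f t))"
proof -
  interpret bounded_linear L by fact
  obtain K where K: "K > 0" "\<And>x. norm (L x) \<le> norm x * K" using pos_bounded by blast
  show ?thesis
  proof (rule abs_continuous_on_dominated[OF f f K(1)])
    fix s t
    have "norm (L (f t) - L (f s)) \<le> K * norm (f t - f s)"
      using K(2)[of "f t - f s"] by (simp add: diff mult.commute)
    also have "\<dots> \<le> K * (norm (f t - f s) + norm (f t - f s))" using K(1) by simp
    finally show "norm (L (f t) - L (f s)) \<le> K * (norm (f t - f s) + norm (f t - f s))" .
  qed
qed

lemma abs_continuous_on_add:
  assumes "abs_continuous_on S f" "abs_continuous_on S g"
  shows "abs_continuous_on S (\<lambda>t. f t + g t)"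
  by (rule abs_continuous_on_dominated[OF assms zero_less_one])
    (simp add: norm_diff_triangle_ineq)

lemma abs_continuous_on_inner:
  fixes f g :: "real \<Rightarrow> 'a::real_inner"
  assumes f: "abs_continuous_on {a..b} f" and g: "abs_continuous_on {a..b} g"
  shows "abs_continuous_on {a..b} (\<lambda>t. f t \<bullet> g t)"
proof -
  have "bounded (f ` {a..b})" "bounded (g ` {a..b})"
    using f g by (auto intro!: compact_imp_bounded compact_continuous_image
        abs_continuous_on_imp_continuous_on)
  then obtain M N where M: "M > 0" "\<And>t. t \<in> {a..b} \<Longrightarrow> norm (f t) \<le> M"
    and N: "N > 0" "\<And>t. t \<in> {a..b} \<Longrightarrow> norm (g t) \<le> N"
    unfolding bounded_pos by (metis imageI)
  show ?thesis
  proof (rule abs_continuous_on_dominated[OF f g])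
    show "M + N > 0" using M N by simp
  next
    fix s t assume s: "s \<in> {a..b}" and t: "t \<in> {a..b}"
    (* The product rule for increments; the undifferentiated factors are bounded on the interval. *)
    have "f t \<bullet> g t - f s \<bullet> g s = (f t - f s) \<bullet> g t + f s \<bullet> (g t - g s)"
      by (simp add: inner_diff_left inner_diff_right)
    then have "norm (f t \<bullet> g t - f s \<bullet> g s) \<le> norm (f t - f s) * norm (g t) + norm (f s) * norm (g t - g s)"
      using Cauchy_Schwarz_ineq2[of "f t - f s" "g t"] Cauchy_Schwarz_ineq2[of "f s" "g t - g s"]
      by simp
    also have "\<dots> \<le> norm (f t - f s) * (M + N) + (M + N) * norm (g t - g s)"
      using M(1) N(1) M(2)[OF s] N(2)[OF t] by (intro add_mono mult_mono) auto
    finally show "norm (f t \<bullet> g t - f s \<bullet> g s) \<le> (M + N) * (norm (f t - f s) + norm (g t - g s))"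
      by (simp add: algebra_simps)
  qed
qed

section \<open>The fundamental theorem of calculus for absolutely continuous functions\<close>

text \<open>
  Turns a cover of the exceptional set by an open set of small measure into the bound on total
  length that the definition of absolute continuity asks for.
\<close>
lemma sum_length_division_le_measure:
  fixes d :: "real set set"
  assumes d: "d division_of \<Union>d" and G: "\<Union>d \<subseteq> G" "G \<in> lmeasurable"
  shows "(\<Sum>k\<in>d. Sup k - Inf k) \<le> measure lebesgue G"
proof -
  have "(\<Sum>k\<in>d. Sup k - Inf k) = (\<Sum>k\<in>d. measure lebesgue k)"
  proof (rule sum.cong[OF refl])
    fix k assume "k \<in> d"
    then obtain u v where "k = cbox u v" "k \<noteq> {}"
      using division_ofD(3,4)[OF d] by metis
    then show "Sup k - Inf k = measure lebesgue k" by auto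
  qed
  also have "\<dots> = measure lebesgue (\<Union>d)"
    using content_division[OF d] by simp
  also have "\<dots> \<le> measure lebesgue G"
    using G d by (intro measure_mono_fmeasurable) (auto simp: lmeasurable_division fmeasurableD)
  finally show ?thesis .
qed

text \<open>
  Two tagged members of a division may share their interval only if it is degenerate, so passing from
  tagged members to intervals loses nothing when the summand vanishes on one-point intervals.
  Absolute continuity speaks of divisions, Riemann sums of tagged ones.
\<close>
lemma sum_tagged_partial_division_real:
  fixes g :: "real \<Rightarrow> real \<Rightarrow> real"
  assumes p: "p tagged_partial_division_of {a..b}" and g: "\<And>t. g t t = 0"
  shows "(\<Sum>(x,k)\<in>p. g (Inf k) (Sup k)) = (\<Sum>k\<in>snd ` p. g (Inf k) (Sup k))"
proof -
  define w where "w k = (if k = {} then 0 else g (Inf k) (Sup k))" for k :: "real set"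
  have ne: "k \<noteq> {}" if "(x,k) \<in> p" for x k
    using tagged_partial_division_ofD(2)[OF p that] by auto
  have "w (cbox u v) = 0" if "box u v = {}" for u v :: real
    using that g by (cases "u = v") (auto simp: w_def)
  then have "(\<Sum>(x,k)\<in>p. w k) = (\<Sum>k\<in>snd ` p. w k)"
    by (intro sum.over_tagged_division_lemma[OF tagged_partial_division_of_Union_self[OF p]]) auto
  moreover have "(\<Sum>(x,k)\<in>p. w k) = (\<Sum>(x,k)\<in>p. g (Inf k) (Sup k))"
    by (rule sum.cong) (auto simp: w_def dest: ne)
  moreover have "(\<Sum>k\<in>snd ` p. w k) = (\<Sum>k\<in>snd ` p. g (Inf k) (Sup k))"
    by (rule sum.cong) (auto simp: w_def dest: ne)
  ultimately show ?thesis by simp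
qed

text \<open>
  A gauge argument. At points outside the null set \<open>E\<close> the gauge makes the increment of \<open>f\<close> close
  to the derivative times the length, as in the classical theorem. At points of \<open>E\<close> it confines the
  interval to an open set of small measure; the intervals tagged there have small total
  length, and absolute continuity makes the sum of the increments of \<open>f\<close> over them small.
\<close>
lemma abs_continuous_has_integral:
  fixes f :: "real \<Rightarrow> 'a::banach"
  assumes ab: "a \<le> b" and ac: "abs_continuous_on {a..b} f" and E: "negligible E"
    and der: "\<And>t. t \<in> {a..b} - E \<Longrightarrow> (f has_vector_derivative g t) (at t within {a..b})"
  shows "(g has_integral f b - f a) {a..b}"
proof -
  (* With the value 0 on E, tags in E contribute only increments of f to the error of a Riemann sum. *)
  define h where "h t = (if t \<in> E then 0 else g t)" for t
  have "(h has_integral f b - f a) {a..b}"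
    unfolding has_integral_real
  proof (intro allI impI)
    fix e :: real assume e: "e > 0"
    (* The summand 1 keeps the denominator positive when a = b. *)
    define e' where "e' = e / (2 * (b - a + 1))"
    have e': "e' > 0" "e' * (b - a) < e / 2" using e ab by (auto simp: e'_def field_simps)
    obtain \<delta> where \<delta>: "\<delta> > 0" and ac\<delta>: "\<And>d. \<lbrakk>d division_of \<Union>d; \<Union>d \<subseteq> {a..b}; (\<Sum>k\<in>d. Sup k - Inf k) < \<delta>\<rbrakk>
        \<Longrightarrow> (\<Sum>k\<in>d. norm (f (Sup k) - f (Inf k))) < e / 2"
      using ac e unfolding abs_continuous_on_def by (meson half_gt_zero)
    have "E \<in> sets lebesgue" using E by (simp add: negligible_imp_sets)
    from sets_lebesgue_outer_open[OF this \<delta>] obtain G where G: "open G" "E \<subseteq> G" "G - E \<in> lmeasurable"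
        "emeasure lebesgue (G - E) < ennreal \<delta>" .
    have GE: "G = (G - E) \<union> E" using G by auto
    have Gm: "G \<in> lmeasurable"
      by (subst GE) (intro fmeasurable.Un G(3) negligible_imp_measurable E)
    have "measure lebesgue G \<le> measure lebesgue (G - E) + measure lebesgue E"
      by (subst GE) (intro measure_Un_le fmeasurableD G(3) negligible_imp_sets E)
    also have "\<dots> = measure lebesgue (G - E)" using E by (simp add: negligible_imp_measure0)
    also have "\<dots> < \<delta>"
      using G(3,4) \<delta> by (simp add: emeasure_eq_measure2 ennreal_less_iff)
    finally have mG: "measure lebesgue G < \<delta>" .
    have "\<exists>r>0. (t \<in> E \<longrightarrow> ball t r \<subseteq> G) \<and>
        (t \<in> {a..b} - E \<longrightarrow> (\<forall>y\<in>{a..b}. norm (y - t) < r \<longrightarrow>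
            norm (f y - f t - (y - t) *\<^sub>R h t) \<le> e' * norm (y - t)))" for t
    proof (cases "t \<in> E")
      case True
      then show ?thesis using G(1,2) by (meson DiffD2 openE subsetD)
    next
      case False
      show ?thesis
      proof (cases "t \<in> {a..b}")
        case True
        then have "(f has_vector_derivative h t) (at t within {a..b})"
          using der False by (auto simp: h_def)
        then show ?thesis using False e'(1)
          unfolding has_vector_derivative_def has_derivative_within_alt by blast
      qed (use False in \<open>auto intro: exI[of _ 1]\<close>)
    qed
    then obtain r where r: "\<And>t. r t > 0" "\<And>t. t \<in> E \<Longrightarrow> ball t (r t) \<subseteq> G"
      "\<And>t y. \<lbrakk>t \<in> {a..b} - E; y \<in> {a..b}; norm (y - t) < r t\<rbrakk> \<Longrightarrow>
            norm (f y - f t - (y - t) *\<^sub>R h t) \<le> e' * norm (y - t)"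
      by metis
    show "\<exists>\<gamma>. gauge \<gamma> \<and> (\<forall>p. p tagged_division_of {a..b} \<and> \<gamma> fine p \<longrightarrow>
            norm ((\<Sum>(x,k)\<in>p. measure lborel k *\<^sub>R h x) - (f b - f a)) < e)"
    proof (intro exI conjI allI impI; (elim conjE)?)
      show "gauge (\<lambda>x. ball x (r x))" using r(1) by (rule gauge_ball_dependent[rule_format])
    next
      fix p assume p: "p tagged_division_of {a..b}" and fine: "(\<lambda>x. ball x (r x)) fine p"
      have fin: "finite p" using p by blast
      define p' where "p' = {z \<in> p. fst z \<in> E}"
      have p'p: "p' \<subseteq> p" by (auto simp: p'_def)
      have tag: "\<exists>u v. K = {u..v} \<and> u \<le> v \<and> a \<le> u \<and> v \<le> b \<and> x \<in> {u..v}
          \<and> {u..v} \<subseteq> ball x (r x)" if xK: "(x,K) \<in> p" for x K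
      proof -
        obtain u v where "K = {u..v}" "x \<in> K" "K \<subseteq> {a..b}"
          using tagged_division_ofD(2-4)[OF p xK] by auto
        moreover have "K \<subseteq> ball x (r x)" using fine xK by (auto simp: fine_def)
        ultimately show ?thesis by auto
      qed
      let ?err = "\<lambda>z. case z of (x,K) \<Rightarrow> measure lborel K *\<^sub>R h x - (f (Sup K) - f (Inf K))"
      have "(\<Sum>(x,k)\<in>p. measure lborel k *\<^sub>R h x) - (f b - f a) = sum ?err p"
        using additive_tagged_division_1[OF ab p, of f] by (simp add: sum_subtractf case_prod_beta)
      also have "\<dots> = sum ?err (p - p') + sum ?err p'"
        by (rule sum.subset_diff[OF p'p fin])
      finally have "norm ((\<Sum>(x,k)\<in>p. measure lborel k *\<^sub>R h x) - (f b - f a))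
          \<le> norm (sum ?err (p - p')) + norm (sum ?err p')"
        by (simp add: norm_triangle_ineq)
      (* Intervals with tag outside E: the straddle estimate at the tag. *)
      moreover have "norm (sum ?err (p - p')) \<le> e' * (b - a)"
      proof -
        have "norm (sum ?err (p - p')) \<le> (\<Sum>(x,K)\<in>p - p'. e' * (Sup K - Inf K))"
        proof (rule sum_norm_le, clarify)
          fix x K assume xK: "(x,K) \<in> p" "(x,K) \<notin> p'"
          then have xE: "x \<notin> E" by (auto simp: p'_def)
          obtain u v where K: "K = {u..v}" "u \<le> v" "a \<le> u" "v \<le> b" "x \<in> {u..v}" "{u..v} \<subseteq> ball x (r x)"
            using tag[OF xK(1)] by blast
          have "u \<in> ball x (r x)" "v \<in> ball x (r x)"
            using subsetD[OF K(6), of u] subsetD[OF K(6), of v] K(2) by auto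
          then have uv: "norm (u - x) < r x" "norm (v - x) < r x"
            by (auto simp: dist_norm norm_minus_commute)
          have "norm ((v - u) *\<^sub>R h x - (f v - f u))
              = norm ((f u - f x - (u - x) *\<^sub>R h x) - (f v - f x - (v - x) *\<^sub>R h x))"
            by (auto simp: algebra_simps)
          also have "\<dots> \<le> norm (f u - f x - (u - x) *\<^sub>R h x) + norm (f v - f x - (v - x) *\<^sub>R h x)"
            by (rule norm_triangle_ineq4)
          also have "\<dots> \<le> e' * norm (u - x) + e' * norm (v - x)"
            using K xE uv by (intro add_mono r(3)) auto
          also have "\<dots> = e' * (v - u)" using K by (simp add: algebra_simps)
          finally show "norm (measure lborel K *\<^sub>R h x - (f (Sup K) - f (Inf K))) \<le> e' * (Sup K - Inf K)"
            using K by simp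
        qed
        also have "\<dots> \<le> (\<Sum>(x,K)\<in>p. e' * (Sup K - Inf K))"
        proof (rule sum_mono2[OF fin])
          fix z assume "z \<in> p - (p - p')"
          then obtain x K where z: "z = (x,K)" "(x,K) \<in> p" by (cases z) auto
          obtain u v where "K = {u..v}" "u \<le> v" using tag[OF z(2)] by blast
          then show "0 \<le> (case z of (x,K) \<Rightarrow> e' * (Sup K - Inf K))" using e'(1) z by simp
        qed auto
        also have "\<dots> = e' * (b - a)"
          using additive_tagged_division_1[OF ab p, of "\<lambda>x. x"]
          by (simp add: sum_distrib_left[symmetric] case_prod_beta)
        finally show ?thesis .
      qed
      (* Intervals with tag in E: here the error is just the sum of the increments of f. *)
      moreover have "norm (sum ?err p') < e / 2"
      proof -
        have pp': "p' tagged_partial_division_of {a..b}"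
          using p unfolding tagged_division_of_def
          by (blast intro: tagged_partial_division_subset[OF _ p'p])
        note div = partial_division_of_tagged_division[OF pp']
        have sub: "\<Union>(snd ` p') \<subseteq> {a..b}" "\<Union>(snd ` p') \<subseteq> G"
        proof -
          have "K \<subseteq> {a..b} \<and> K \<subseteq> G" if xK: "(x,K) \<in> p'" for x K
          proof -
            have "(x,K) \<in> p" "x \<in> E" using xK by (auto simp: p'_def)
            then show ?thesis
              using tag[OF \<open>(x,K) \<in> p\<close>] r(2)[of x] tagged_division_ofD(3)[OF p] by blast
          qed
          then show "\<Union>(snd ` p') \<subseteq> {a..b}" "\<Union>(snd ` p') \<subseteq> G" by force+
        qed
        have "norm (sum ?err p') \<le> (\<Sum>(x,K)\<in>p'. norm (f (Sup K) - f (Inf K)))"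
        proof (rule sum_norm_le, clarify)
          fix x K assume "(x,K) \<in> p'"
          then show "norm (measure lborel K *\<^sub>R h x - (f (Sup K) - f (Inf K))) \<le> norm (f (Sup K) - f (Inf K))"
            by (simp add: p'_def h_def norm_minus_commute)
        qed
        also have "\<dots> = (\<Sum>K\<in>snd ` p'. norm (f (Sup K) - f (Inf K)))"
          by (rule sum_tagged_partial_division_real[OF pp', of "\<lambda>s t. norm (f t - f s)"]) simp
        also have "\<dots> < e / 2"
          using sum_length_division_le_measure[OF div sub(2) Gm] mG
          by (intro ac\<delta> div sub) simp
        finally show ?thesis .
      qed
      ultimately show "norm ((\<Sum>(x,k)\<in>p. measure lborel k *\<^sub>R h x) - (f b - f a)) < e"
        using e'(2) by linarith
    qed
  qed
  then show ?thesis
    by (rule has_integral_spike[OF E, rotated]) (auto simp: h_def)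
qed

section \<open>Functions that are primitives almost everywhere\<close>

text \<open>
  The pair is kept together because the derivative of an absolutely continuous function is
  determined only almost everywhere: the calculus rules then read like those for everywhere
  differentiable functions, and the second component may be changed on a null set.
\<close>
definition ac_with_derivative :: "(real \<Rightarrow> 'a::real_normed_vector) \<Rightarrow> (real \<Rightarrow> 'a) \<Rightarrow> bool" where
  "ac_with_derivative f g \<longleftrightarrow> abs_continuous_on {0..1} f \<and>
     (AE t in lebesgue_on {0..1}. (f has_vector_derivative g t) (at t within {0..1}))"

lemma AE_lebesgue_on_unit_interval_iff:
  "(AE t in lebesgue_on {0..1::real}. P t) \<longleftrightarrow> (AE t in lebesgue. t \<in> {0..1} \<longrightarrow> P t)"
  by (rule AE_restrict_space_iff) simp

lemma AE_lebesgue_onI: "(\<And>t. t \<in> {0..1::real} \<Longrightarrow> P t) \<Longrightarrow> AE t in lebesgue_on {0..1}. P t"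
  by (rule AE_I2) simp

lemma ac_with_derivative_has_integral:
  fixes f :: "real \<Rightarrow> 'a::banach"
  assumes "ac_with_derivative f g"
  shows "(g has_integral f 1 - f 0) {0..1}"
proof -
  have "AE t in lebesgue. t \<in> {0..1} \<longrightarrow> (f has_vector_derivative g t) (at t within {0..1})"
    using assms by (simp add: ac_with_derivative_def AE_lebesgue_on_unit_interval_iff)
  then obtain E where E: "E \<in> null_sets lebesgue"
    "{t. \<not> (t \<in> {0..1} \<longrightarrow> (f has_vector_derivative g t) (at t within {0..1}))} \<subseteq> E"
    unfolding eventually_ae_filter by auto
  show ?thesis
    using assms E
    by (intro abs_continuous_has_integral[where E=E])
      (auto simp: ac_with_derivative_def negligible_iff_null_sets)
qed

lemma ac_with_derivative_cong_AE:
  assumes "ac_with_derivative f g" "AE t in lebesgue_on {0..1}. g t = h t"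
  shows "ac_with_derivative f h"
proof -
  have "AE t in lebesgue_on {0..1}. (f has_vector_derivative g t) (at t within {0..1})"
    using assms by (simp add: ac_with_derivative_def)
  with assms(2) have "AE t in lebesgue_on {0..1}. (f has_vector_derivative h t) (at t within {0..1})"
    by eventually_elim simp
  then show ?thesis using assms(1) by (simp add: ac_with_derivative_def)
qed

lemma ac_with_derivative_const: "ac_with_derivative (\<lambda>t. c) (\<lambda>t. 0)"
  by (simp add: ac_with_derivative_def abs_continuous_on_const)

lemma ac_with_derivative_add:
  assumes "ac_with_derivative f f'" "ac_with_derivative g g'"
  shows "ac_with_derivative (\<lambda>t. f t + g t) (\<lambda>t. f' t + g' t)"
proof -
  have "AE t in lebesgue_on {0..1}. (f has_vector_derivative f' t) (at t within {0..1})"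
    and "AE t in lebesgue_on {0..1}. (g has_vector_derivative g' t) (at t within {0..1})"
    using assms by (auto simp: ac_with_derivative_def)
  then have "AE t in lebesgue_on {0..1}.
      ((\<lambda>t. f t + g t) has_vector_derivative f' t + g' t) (at t within {0..1})"
    by eventually_elim (rule has_vector_derivative_add)
  then show ?thesis
    using assms by (simp add: ac_with_derivative_def abs_continuous_on_add)
qed

lemma ac_with_derivative_sum:
  assumes "\<And>i. i \<in> I \<Longrightarrow> ac_with_derivative (f i) (f' i)"
  shows "ac_with_derivative (\<lambda>t. \<Sum>i\<in>I. f i t) (\<lambda>t. \<Sum>i\<in>I. f' i t)"
  using assms
  by (induction I rule: infinite_finite_induct)
    (simp_all add: ac_with_derivative_const ac_with_derivative_add)

lemma ac_with_derivative_bounded_linear: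
  assumes "bounded_linear L" "ac_with_derivative f f'"
  shows "ac_with_derivative (\<lambda>t. L (f t)) (\<lambda>t. L (f' t))"
proof -
  have "AE t in lebesgue_on {0..1}. (f has_vector_derivative f' t) (at t within {0..1})"
    using assms by (auto simp: ac_with_derivative_def)
  then have "AE t in lebesgue_on {0..1}.
      ((\<lambda>t. L (f t)) has_vector_derivative L (f' t)) (at t within {0..1})"
    by eventually_elim (rule bounded_linear.has_vector_derivative[OF assms(1)])
  then show ?thesis
    using assms by (simp add: ac_with_derivative_def abs_continuous_on_bounded_linear)
qed

lemma ac_with_derivative_inner:
  fixes f g :: "real \<Rightarrow> 'a::real_inner"
  assumes "ac_with_derivative f f'" "ac_with_derivative g g'"
  shows "ac_with_derivative (\<lambda>t. f t \<bullet> g t) (\<lambda>t. f t \<bullet> g' t + f' t \<bullet> g t)"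
proof -
  have "AE t in lebesgue_on {0..1}. (f has_vector_derivative f' t) (at t within {0..1})"
    and "AE t in lebesgue_on {0..1}. (g has_vector_derivative g' t) (at t within {0..1})"
    using assms by (auto simp: ac_with_derivative_def)
  then have "AE t in lebesgue_on {0..1}.
      ((\<lambda>t. f t \<bullet> g t) has_vector_derivative f t \<bullet> g' t + f' t \<bullet> g t) (at t within {0..1})"
    by eventually_elim (rule bounded_bilinear.has_vector_derivative[OF bounded_bilinear_inner])
  then show ?thesis
    using assms by (simp add: ac_with_derivative_def abs_continuous_on_inner)
qed

text \<open>
  The constant \<open>D\<close> uses an unspecified value where no derivative exists; this identifies it almost
  everywhere, also for a function known only through its values on the unit interval.
\<close>
lemma ac_with_derivative_unique:
  fixes f :: "real \<Rightarrow> 'a::euclidean_space"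
  assumes f: "ac_with_derivative f f'" and eq: "\<And>t. t \<in> {0..1} \<Longrightarrow> h t = f t"
  shows "AE t in lebesgue_on {0..1}. D 1 h t = f' t"
proof -
  have "AE t in lebesgue_on {0..1}. (f has_vector_derivative f' t) (at t within {0..1})"
    using f by (auto simp: ac_with_derivative_def)
  moreover have "AE t in lebesgue_on {0..1::real}. t \<in> {0..1}" by (rule AE_lebesgue_onI)
  ultimately show ?thesis
  proof eventually_elim
    case (elim t)
    then have "(h has_vector_derivative f' t) (at t within {0..1})"
      by (intro has_vector_derivative_transform[OF elim(2) eq])
    then show ?case
      using elim(2) vector_derivative_within_closed_interval[of 0 1 t h] by (simp add: D_def)
  qed
qed

text \<open>
  The zero set of the difference is closed, and a closed set of full measure contains every interior
  point of the interval, hence its closure.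
\<close>
lemma continuous_on_AE_eq_imp_eq:
  fixes f g :: "real \<Rightarrow> 'a::real_normed_vector"
  assumes f: "continuous_on {0..1} f" and g: "continuous_on {0..1} g"
    and AE: "AE t in lebesgue_on {0..1}. f t = g t" and t: "t \<in> {0..1}"
  shows "f t = g t"
proof -
  let ?C = "{t \<in> {0..1}. f t - g t = 0}"
  have "continuous_on {0..1} (\<lambda>t. f t - g t)" by (intro continuous_intros f g)
  then have C: "closed ?C" by (rule continuous_closed_preimage_constant) simp
  have "AE t \<in> {0<..<1} in lebesgue. t \<in> ?C"
    using AE unfolding AE_lebesgue_on_unit_interval_iff by eventually_elim auto
  then have "s \<in> ?C" if "s \<in> {0<..<1}" for s
    using mem_closed_if_AE_lebesgue_open[OF open_greaterThanLessThan C] that by blast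
  then have "closure {0<..<1} \<subseteq> ?C" by (intro closure_minimal C) blast
  then show ?thesis using t by (auto simp: subset_iff)
qed

section \<open>Equality in the inequalities of convex duality\<close>

lemma support_fun_ge: "z \<in> S \<Longrightarrow> ereal (z \<bullet> y) \<le> support_fun S y"
  unfolding support_fun_def by (rule SUP_upper)

lemma support_fun_eq_iff:
  assumes "z \<in> S"
  shows "support_fun S y = ereal (z \<bullet> y) \<longleftrightarrow> (\<forall>w\<in>S. w \<bullet> y \<le> z \<bullet> y)"
proof
  assume eq: "support_fun S y = ereal (z \<bullet> y)"
  show "\<forall>w\<in>S. w \<bullet> y \<le> z \<bullet> y"
  proof
    fix w assume "w \<in> S"
    from support_fun_ge[OF this, of y] show "w \<bullet> y \<le> z \<bullet> y" unfolding eq by simp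
  qed
next
  assume "\<forall>w\<in>S. w \<bullet> y \<le> z \<bullet> y"
  then show "support_fun S y = ereal (z \<bullet> y)"
    by (intro antisym[OF _ support_fun_ge[OF assms]]) (simp add: support_fun_def SUP_le_iff)
qed

lemma dual_cone_at_iff: "zs \<in> dual_cone_at S z \<longleftrightarrow> (\<forall>w\<in>S. (w - z) \<bullet> zs \<ge> 0)"
proof
  assume zs: "zs \<in> dual_cone_at S z"
  show "\<forall>w\<in>S. (w - z) \<bullet> zs \<ge> 0"
  proof
    fix w assume "w \<in> S"
    then have "1 *\<^sub>R (w - z) \<in> cone_at S z" unfolding cone_at_def
      using zero_less_one by blast
    then show "(w - z) \<bullet> zs \<ge> 0" using zs unfolding dual_cone_at_def by fastforce
  qed
qed (auto simp: dual_cone_at_def cone_at_def)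

text \<open>
  The transversality conditions at 0 say that the supremum in a support function is attained at the
  initial data of the trajectory.
\<close>
lemma dual_cone_at_iff_support:
  assumes "z \<in> S"
  shows "- y \<in> dual_cone_at S z \<longleftrightarrow> support_fun S y = ereal (z \<bullet> y)"
  using assms by (auto simp: support_fun_eq_iff dual_cone_at_iff inner_diff_left)

lemma conjugate_fun_ge: "ereal (z \<bullet> y - f z) \<le> conjugate_fun f y"
  unfolding conjugate_fun_def by (rule SUP_upper) simp

text \<open>
  The equality case of the Fenchel--Young inequality.
\<close>
lemma subdifferential_iff_conjugate:
  "y \<in> subdifferential f z \<longleftrightarrow> conjugate_fun f y = ereal (z \<bullet> y - f z)"
proof
  assume "y \<in> subdifferential f z"
  then have "w \<bullet> y - f w \<le> z \<bullet> y - f z" for w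
    by (auto simp: subdifferential_def inner_diff_left algebra_simps)
  then show "conjugate_fun f y = ereal (z \<bullet> y - f z)"
    by (intro antisym[OF _ conjugate_fun_ge]) (simp add: conjugate_fun_def SUP_le_iff)
next
  assume "conjugate_fun f y = ereal (z \<bullet> y - f z)"
  then have "w \<bullet> y - f w \<le> z \<bullet> y - f z" for w
    using conjugate_fun_ge[of w y f] by simp
  then show "y \<in> subdifferential f z"
    by (auto simp: subdifferential_def inner_diff_left algebra_simps)
qed

section \<open>Extended-real integrals bounded below by an integrable function\<close>

text \<open>
  A supremum of continuous functions is lower semicontinuous, so its strict superlevel sets are
  relatively open. This covers uncountable \<open>U\<close>, where measurability is not inherited from the
  individual functions.
\<close>
lemma borel_measurable_support_fun:
  fixes S :: "'b::euclidean_space set"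
  assumes g: "continuous_on S g" and S: "S \<in> sets lebesgue"
  shows "(\<lambda>t. support_fun U (g t)) \<in> borel_measurable (lebesgue_on S)"
proof (rule borel_measurableI_greater)
  fix y :: ereal
  have "openin (top_of_set S) {t \<in> S. y < ereal (u \<bullet> g t)}" for u
  proof -
    have "continuous_on S (\<lambda>t. ereal (u \<bullet> g t))" by (intro continuous_intros g)
    from continuous_openin_preimage_gen[OF this open_greaterThan[of y]]
    show ?thesis by (simp add: vimage_def Int_def)
  qed
  then have "openin (top_of_set S) (\<Union>u\<in>U. {t \<in> S. y < ereal (u \<bullet> g t)})" by blast
  moreover have "(\<Union>u\<in>U. {t \<in> S. y < ereal (u \<bullet> g t)}) = {t \<in> space (lebesgue_on S). y < support_fun U (g t)}"
    by (auto simp: support_fun_def less_SUP_iff)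
  ultimately obtain T where "open T" "{t \<in> space (lebesgue_on S). y < support_fun U (g t)} = S \<inter> T"
    unfolding openin_open by auto
  then show "{t \<in> space (lebesgue_on S). y < support_fun U (g t)} \<in> sets (lebesgue_on S)"
    using S by (auto simp: sets_restrict_space)
qed

text \<open>
  The positive part of \<open>f\<close> dominates that of \<open>r\<close> and the negative part is dominated by that of \<open>r\<close>. Hence
  the negative part of \<open>f\<close> has a finite integral, the difference of the two integrals is never
  \<open>\<infinity> - \<infinity>\<close>, and equality of the integrals forces equality of both parts almost everywhere.
\<close>
lemma
  assumes r: "integrable M r" and fr: "AE t in M. ereal (r t) \<le> f t"
  shows ereal_integral_ge: "ereal (integral\<^sup>L M r) \<le> ereal_integral M f"
    and ereal_integral_eq_imp_AE:
      "\<lbrakk>f \<in> borel_measurable M; ereal_integral M f = ereal (integral\<^sup>L M r)\<rbrakk> \<Longrightarrow> AE t in M. f t = ereal (r t)"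
proof -
  let ?P = "\<integral>\<^sup>+ t. e2ennreal (f t) \<partial>M" and ?N = "\<integral>\<^sup>+ t. e2ennreal (- f t) \<partial>M"
  let ?p = "\<integral>\<^sup>+ t. ennreal (r t) \<partial>M" and ?n = "\<integral>\<^sup>+ t. ennreal (- r t) \<partial>M"
  have fin: "?p \<noteq> \<infinity>" "?n \<noteq> \<infinity>" using r by (auto simp: real_integrable_def)
  have pw: "AE t in M. ennreal (r t) \<le> e2ennreal (f t) \<and> e2ennreal (- f t) \<le> ennreal (- r t)"
    using fr
  proof eventually_elim
    case (elim t)
    then have "- f t \<le> ereal (- r t)" by (metis ereal_minus_le_minus uminus_ereal.simps(1))
    with elim show ?case using e2ennreal_mono by fastforce
  qed
  have pP: "?p \<le> ?P" and Nn: "?N \<le> ?n"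
    using pw by (auto intro!: nn_integral_mono_AE)
  obtain p where p: "p \<ge> 0" "?p = ennreal p" using fin(1) by (cases ?p) auto
  obtain n where n: "n \<ge> 0" "?n = ennreal n" using fin(2) by (cases ?n) auto
  have "?N \<noteq> \<infinity>" using Nn fin(2) by (auto simp: top_unique)
  then obtain n' where n': "n' \<ge> 0" "?N = ennreal n'" by (cases ?N) auto
  have int: "integral\<^sup>L M r = p - n"
    using real_lebesgue_integral_def[OF r] p n by simp
  have n'n: "n' \<le> n" using Nn n n' by (simp add: ennreal_le_iff)
  have cases_P: "?P = \<infinity> \<or> (\<exists>p'. p' \<ge> p \<and> ?P = ennreal p')"
  proof (cases ?P)
    case (real p')
    then show ?thesis using pP p by (auto simp: ennreal_le_iff intro!: exI[of _ p'])
  qed auto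
  show "ereal (integral\<^sup>L M r) \<le> ereal_integral M f"
    using cases_P p(1) n' n'n int by (auto simp: ereal_integral_def enn2ereal_ennreal)
  assume f: "f \<in> borel_measurable M" and eq: "ereal_integral M f = ereal (integral\<^sup>L M r)"
  have Pp: "?P = ?p" and nN: "?N = ?n"
    using cases_P p n n' n'n int eq by (auto simp: ereal_integral_def enn2ereal_ennreal)
  have [measurable]: "f \<in> borel_measurable M" "r \<in> borel_measurable M" using f r by auto
  have "AE t in M. e2ennreal (f t) = ennreal (r t)"
  proof -
    have "(\<integral>\<^sup>+ t. e2ennreal (f t) - ennreal (r t) \<partial>M) = ?P - ?p"
      using fin pw by (intro nn_integral_diff) auto
    then have "(\<integral>\<^sup>+ t. e2ennreal (f t) - ennreal (r t) \<partial>M) = 0" using Pp fin by simp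
    then have "AE t in M. e2ennreal (f t) - ennreal (r t) = 0"
      by (subst (asm) nn_integral_0_iff_AE) auto
    with pw show ?thesis
      by eventually_elim (auto simp: diff_eq_0_iff_ennreal intro: antisym)
  qed
  moreover have "AE t in M. e2ennreal (- f t) = ennreal (- r t)"
  proof -
    have "(\<integral>\<^sup>+ t. ennreal (- r t) - e2ennreal (- f t) \<partial>M) = ?n - ?N"
      using n' pw by (intro nn_integral_diff) auto
    then have "(\<integral>\<^sup>+ t. ennreal (- r t) - e2ennreal (- f t) \<partial>M) = 0" using nN fin by simp
    then have "AE t in M. ennreal (- r t) - e2ennreal (- f t) = 0"
      by (subst (asm) nn_integral_0_iff_AE) auto
    with pw show ?thesis
      by eventually_elim (auto simp: diff_eq_0_iff_ennreal intro: antisym)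
  qed
  ultimately show "AE t in M. f t = ereal (r t)"
  proof eventually_elim
    case (elim t)
    show ?case
    proof (cases "f t")
      case (real x)
      then have "ennreal x = ennreal (r t)" "ennreal (- x) = ennreal (- r t)" using elim by auto
      then show ?thesis using real
        by (cases "x \<ge> 0"; cases "r t \<ge> 0") (auto simp: ennreal_neg)
    qed (use elim in auto)
  qed
qed

lemma ereal_integral_cong_AE:
  assumes r: "integrable M r" and fr: "AE t in M. f t = ereal (r t)"
  shows "ereal_integral M f = ereal (integral\<^sup>L M r)"
proof -
  have P: "(\<integral>\<^sup>+ t. e2ennreal (f t) \<partial>M) = (\<integral>\<^sup>+ t. ennreal (r t) \<partial>M)"
    by (rule nn_integral_cong_AE) (use fr in eventually_elim, simp)
  have N: "(\<integral>\<^sup>+ t. e2ennreal (- f t) \<partial>M) = (\<integral>\<^sup>+ t. ennreal (- r t) \<partial>M)"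
    by (rule nn_integral_cong_AE) (use fr in eventually_elim, simp)
  obtain p where p: "p \<ge> 0" "(\<integral>\<^sup>+ t. ennreal (r t) \<partial>M) = ennreal p"
    using r by (cases "\<integral>\<^sup>+ t. ennreal (r t) \<partial>M") (auto simp: real_integrable_def)
  obtain n where n: "n \<ge> 0" "(\<integral>\<^sup>+ t. ennreal (- r t) \<partial>M) = ennreal n"
    using r by (cases "\<integral>\<^sup>+ t. ennreal (- r t) \<partial>M") (auto simp: real_integrable_def)
  show ?thesis
    unfolding ereal_integral_def real_lebesgue_integral_def[OF r] P N
    using p n by (simp add: enn2ereal_ennreal)
qed

section \<open>Iterated derivatives of regular functions\<close>

lemma D_0 [simp]: "D 0 f = f"
  by (simp add: D_def)

lemma D_Suc: "D (Suc j) f t = vector_derivative (D j f) (at t within {0..1})"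
  by (simp add: D_def)

lemma regular_ac_with_derivative:
  assumes x: "regular m x" and j: "j < m"
  shows "ac_with_derivative (D j x) (D (Suc j) x)"
proof -
  have "AE t in lebesgue_on {0..1}. D j x differentiable (at t within {0..1})"
  proof (cases "j + 1 < m")
    case True
    then show ?thesis using x by (intro AE_lebesgue_onI) (simp add: regular_def)
  next
    case False
    then have "j = m - 1" using j by simp
    then show ?thesis using x by (simp add: regular_def)
  qed
  then have "AE t in lebesgue_on {0..1}. (D j x has_vector_derivative D (Suc j) x t) (at t within {0..1})"
    by eventually_elim (simp add: D_Suc vector_derivative_works)
  then show ?thesis using x j by (simp add: ac_with_derivative_def regular_def)
qed

lemma regular_continuous_on: "\<lbrakk>regular m x; j < m\<rbrakk> \<Longrightarrow> continuous_on {0..1} (D j x)"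
  using abs_continuous_on_imp_continuous_on unfolding regular_def by blast

section \<open>Costates and the Lagrange identity\<close>

lemma eta_of_0 [simp]: "eta_of \<kappa> A xs 0 t = 0"
  by (simp add: eta_of_def)

text \<open>
  The recursion \<open>\<eta>\<^sub>j\<^sub>+\<^sub>1 = A\<^sub>\<kappa>\<^sub>-\<^sub>j\<^sub>-\<^sub>1\<^sup>* x\<^sup>* - \<eta>\<^sub>j'\<close>, with the derivative written out.
\<close>
lemma eta_of_Suc:
  assumes "Suc j \<le> \<kappa>"
  shows "eta_of \<kappa> A xs (Suc j) t = transpose (A (\<kappa> - Suc j)) *v xs t
    - (\<Sum>i<j. (-1) ^ i *\<^sub>R (transpose (A (\<kappa> - j + i)) *v D (Suc i) xs t))"
proof -
  have idx: "\<kappa> - Suc j + Suc i = \<kappa> - j + i" for i using assms by simp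
  show ?thesis
    unfolding eta_of_def sum.lessThan_Suc_shift idx by (simp add: sum_negf)
qed

lemma eta_of_ac_with_derivative:
  fixes A :: "nat \<Rightarrow> real^'n^'n"
  assumes xs: "regular \<kappa> xs" and j: "j < \<kappa>"
  shows "ac_with_derivative (eta_of \<kappa> A xs j)
    (\<lambda>t. transpose (A (\<kappa> - Suc j)) *v xs t - eta_of \<kappa> A xs (Suc j) t)"
proof -
  have "ac_with_derivative
    (\<lambda>t. \<Sum>i<j. (-1) ^ i *\<^sub>R (transpose (A (\<kappa> - j + i)) *v D i xs t))
    (\<lambda>t. \<Sum>i<j. (-1) ^ i *\<^sub>R (transpose (A (\<kappa> - j + i)) *v D (Suc i) xs t))"
    using j
    by (intro ac_with_derivative_sum ac_with_derivative_bounded_linear[OF bounded_linear_scaleR_right]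
        ac_with_derivative_bounded_linear[OF matrix_vector_mul_bounded_linear]
        regular_ac_with_derivative[OF xs]) auto
  moreover have "eta_of \<kappa> A xs j = (\<lambda>t. \<Sum>i<j. (-1) ^ i *\<^sub>R (transpose (A (\<kappa> - j + i)) *v D i xs t))"
    by (simp only: eta_of_def[abs_def])
  moreover have "(\<lambda>t. transpose (A (\<kappa> - Suc j)) *v xs t - eta_of \<kappa> A xs (Suc j) t)
      = (\<lambda>t. \<Sum>i<j. (-1) ^ i *\<^sub>R (transpose (A (\<kappa> - j + i)) *v D (Suc i) xs t))"
    using j by (simp add: eta_of_Suc[OF Suc_leI[OF j]])
  ultimately show ?thesis by (simp only:)
qed

text \<open>
  The coefficients that the boundary terms of the dual problem and of the optimality conditions have
  in common: they are the multipliers of \<open>x\<^sup>(\<^sup>\<kappa>\<^sup>-\<^sup>1\<^sup>-\<^sup>j\<^sup>)\<close> when the differential equation is integrated by parts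
  against \<open>x\<^sup>*\<close>. The index \<open>j = \<kappa>\<close> is allowed, and there the function vanishes at exactly those
  points where the Euler--Lagrange equation holds.
\<close>
definition costate where
  "costate \<kappa> A xs j t = (-1) ^ Suc j *\<^sub>R D j xs t + eta_of \<kappa> A xs j t"

lemma costate_0: "costate \<kappa> A xs 0 t = - xs t"
  by (simp add: costate_def)

text \<open>
  The Euler--Lagrange equation as a first-order system: each costate is, up to a term in \<open>x\<^sup>*\<close>, minus
  the derivative of the preceding one.
\<close>
lemma costate_ac_with_derivative:
  fixes A :: "nat \<Rightarrow> real^'n^'n"
  assumes xs: "regular \<kappa> xs" and j: "j < \<kappa>"
  shows "ac_with_derivative (costate \<kappa> A xs j)
    (\<lambda>t. transpose (A (\<kappa> - Suc j)) *v xs t - costate \<kappa> A xs (Suc j) t)"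
proof -
  have "ac_with_derivative (\<lambda>t. (-1) ^ Suc j *\<^sub>R D j xs t + eta_of \<kappa> A xs j t)
    (\<lambda>t. (-1) ^ Suc j *\<^sub>R D (Suc j) xs t
       + (transpose (A (\<kappa> - Suc j)) *v xs t - eta_of \<kappa> A xs (Suc j) t))"
    by (intro ac_with_derivative_add ac_with_derivative_bounded_linear[OF bounded_linear_scaleR_right]
        regular_ac_with_derivative[OF xs j] eta_of_ac_with_derivative[OF xs j])
  then show ?thesis by (simp add: costate_def[abs_def] algebra_simps)
qed

lemma euler_lagrange_iff_costate:
  "xs \<in> euler_lagrange_solutions \<kappa> A \<longleftrightarrow>
    regular \<kappa> xs \<and> (AE t in lebesgue_on {0..1}. costate \<kappa> A xs \<kappa> t = 0)"
proof -
  have "costate \<kappa> A xs \<kappa> t = 0 \<longleftrightarrow>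
     (-1) ^ \<kappa> *\<^sub>R D \<kappa> xs t = (\<Sum>j<\<kappa>. (-1) ^ j *\<^sub>R (transpose (A j) *v D j xs t))" for t
    by (auto simp: costate_def eta_of_def)
  then show ?thesis by (simp add: euler_lagrange_solutions_def)
qed

lemma inner_transpose_mult_vector: "x \<bullet> (transpose M *v y) = (M *v x) \<bullet> (y :: real^'m)"
  for M :: "real^'n^'m"
  by (metis dot_lmul_matrix inner_commute transpose_matrix_vector)

text \<open>
  In the derivative of \<open>H\<close> the terms coupling \<open>D (\<kappa> - j) x\<close> with the costate \<open>j\<close> telescope, by
  the first-order system for the costates. There remain the term with index 0, where the costate is
  \<open>-x\<^sup>*\<close>, the term with index \<open>\<kappa>\<close>, which the Euler--Lagrange equation removes, and the terms with
  the matrices. So \<open>H\<close> is a primitive of minus the integrand.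
\<close>
lemma lagrange_identity:
  fixes A :: "nat \<Rightarrow> real^'n^'n"
  assumes x: "regular \<kappa> x" and xs: "xs \<in> euler_lagrange_solutions \<kappa> A"
  defines "H \<equiv> \<lambda>t. \<Sum>j<\<kappa>. D (\<kappa> - Suc j) x t \<bullet> costate \<kappa> A xs j t"
  shows "((\<lambda>t. (D \<kappa> x t - (\<Sum>j<\<kappa>. A j *v D j x t)) \<bullet> xs t) has_integral H 0 - H 1) {0..1}"
proof -
  have reg: "regular \<kappa> xs" and EL: "AE t in lebesgue_on {0..1}. costate \<kappa> A xs \<kappa> t = 0"
    using xs by (auto simp: euler_lagrange_iff_costate)
  define H' where "H' t = (\<Sum>j<\<kappa>. D (\<kappa> - Suc j) x t \<bullet>
      (transpose (A (\<kappa> - Suc j)) *v xs t - costate \<kappa> A xs (Suc j) t)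
      + D (Suc (\<kappa> - Suc j)) x t \<bullet> costate \<kappa> A xs j t)" for t
  have HH': "ac_with_derivative H H'"
    unfolding H_def H'_def
    by (intro ac_with_derivative_sum ac_with_derivative_inner regular_ac_with_derivative[OF x]
        costate_ac_with_derivative[OF reg]) auto
  have H': "H' t = (\<Sum>j<\<kappa>. A j *v D j x t) \<bullet> xs t - D \<kappa> x t \<bullet> xs t
      - x t \<bullet> costate \<kappa> A xs \<kappa> t" for t
  proof -
    let ?a = "\<lambda>j. D (\<kappa> - j) x t \<bullet> costate \<kappa> A xs j t"
    have "H' t = (\<Sum>j<\<kappa>. (A (\<kappa> - Suc j) *v D (\<kappa> - Suc j) x t) \<bullet> xs t + (?a j - ?a (Suc j)))"
      unfolding H'_def
    proof (rule sum.cong[OF refl])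
      fix j assume "j \<in> {..<\<kappa>}"
      then have "Suc (\<kappa> - Suc j) = \<kappa> - j" by auto
      then show "D (\<kappa> - Suc j) x t \<bullet> (transpose (A (\<kappa> - Suc j)) *v xs t - costate \<kappa> A xs (Suc j) t)
          + D (Suc (\<kappa> - Suc j)) x t \<bullet> costate \<kappa> A xs j t
        = (A (\<kappa> - Suc j) *v D (\<kappa> - Suc j) x t) \<bullet> xs t + (?a j - ?a (Suc j))"
        by (simp add: inner_diff_right inner_transpose_mult_vector del: transpose_matrix_vector)
    qed
    also have "\<dots> = (\<Sum>j<\<kappa>. (A (\<kappa> - Suc j) *v D (\<kappa> - Suc j) x t) \<bullet> xs t) + (?a 0 - ?a \<kappa>)"
      unfolding sum.distrib using sum_lessThan_telescope'[of ?a \<kappa>] by simp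
    also have "(\<Sum>j<\<kappa>. (A (\<kappa> - Suc j) *v D (\<kappa> - Suc j) x t) \<bullet> xs t) = (\<Sum>j<\<kappa>. A j *v D j x t) \<bullet> xs t"
      by (simp add: inner_sum_left sum.nat_diff_reindex[where g="\<lambda>j. (A j *v D j x t) \<bullet> xs t"])
    finally show ?thesis by (simp add: costate_0)
  qed
  have "ac_with_derivative H (\<lambda>t. - ((D \<kappa> x t - (\<Sum>j<\<kappa>. A j *v D j x t)) \<bullet> xs t))"
    by (rule ac_with_derivative_cong_AE[OF HH'])
      (use EL in eventually_elim, simp add: H' inner_diff_left)
  from has_integral_neg[OF ac_with_derivative_has_integral[OF this]]
  show ?thesis by simp
qed

lemma integrable_residual_inner:
  fixes A :: "nat \<Rightarrow> real^'n^'n"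
  assumes x: "regular \<kappa> x" and xs: "continuous_on {0..1} xs"
  shows "integrable (lebesgue_on {0..1}) (\<lambda>t. (D \<kappa> x t - (\<Sum>j<\<kappa>. A j *v D j x t)) \<bullet> xs t)"
proof -
  have cont: "continuous_on {0..1} (\<lambda>t. \<Sum>j<\<kappa>. A j *v D j x t)"
    by (intro continuous_on_sum bounded_linear.continuous_on[OF matrix_vector_mul_bounded_linear]
        regular_continuous_on[OF x]) simp
  have ai: "(\<lambda>t. D \<kappa> x t - (\<Sum>j<\<kappa>. A j *v D j x t)) absolutely_integrable_on {0..1}"
    using x absolutely_integrable_continuous_real[OF cont]
    by (intro set_integral_diff) (simp_all add: regular_def)
  have meas: "xs \<in> borel_measurable (lebesgue_on {0..1})"
    by (rule continuous_imp_measurable_on_sets_lebesgue[OF xs]) simp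
  have bdd: "bounded (xs ` {0..1})"
    by (rule compact_imp_bounded[OF compact_continuous_image[OF xs compact_Icc]])
  have bil: "bilinear ((\<bullet>) :: real^'n \<Rightarrow> real^'n \<Rightarrow> real)"
    by (simp add: bilinear_conv_bounded_bilinear bounded_bilinear_inner)
  have "(\<lambda>t. xs t \<bullet> (D \<kappa> x t - (\<Sum>j<\<kappa>. A j *v D j x t))) absolutely_integrable_on {0..1}"
    by (rule absolutely_integrable_bounded_measurable_product[OF bil meas _ bdd ai]) simp
  from absolutely_integrable_imp_integrable[OF this] show ?thesis
    unfolding inner_commute[of "xs _"] by simp
qed

section \<open>The adjoint inclusion as an Euler--Lagrange system\<close>

text \<open>
  The inequality that defines the dual cone holds for all \<open>z'\<close> and all controls. Varying the control
  at fixed \<open>z\<close> gives the maximum principle. Varying \<open>z\<close> over the whole space at a fixed control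
  gives an inequality for a linear functional, which must therefore vanish.
\<close>
lemma locally_adjoint_semilinear:
  fixes A :: "nat \<Rightarrow> real^'n^'n" and B :: "real^'r^'n"
  assumes zs: "zs \<in> locally_adjoint (semilinear \<iota> A B U) vs (z, v)"
    and u: "u \<in> U" and v: "v = (\<Sum>i\<in>UNIV. A (\<iota> i) *v (z $ i)) + B *v u"
  shows "zs $ i = transpose (A (\<iota> i)) *v vs"
    and "w \<in> U \<Longrightarrow> (B *v w) \<bullet> vs \<le> (B *v u) \<bullet> vs"
proof -
  have ineq: "(z' - z) \<bullet> zs \<ge> ((\<Sum>i\<in>UNIV. A (\<iota> i) *v (z' $ i)) + B *v w - v) \<bullet> vs"
    if "w \<in> U" for z' w
  proof -
    have "(z', (\<Sum>i\<in>UNIV. A (\<iota> i) *v (z' $ i)) + B *v w) \<in> gph (semilinear \<iota> A B U)"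
      using that by (auto simp: gph_def semilinear_def)
    then show ?thesis
      using zs by (fastforce simp: locally_adjoint_def dual_cone_at_iff inner_Pair)
  qed
  show "w \<in> U \<Longrightarrow> (B *v w) \<bullet> vs \<le> (B *v u) \<bullet> vs"
    using ineq[of w z] by (simp add: v algebra_simps inner_diff_left)
  define d where "d = (\<chi> i. zs $ i - transpose (A (\<iota> i)) *v vs)"
  (* Move from z against d, the defect of the claimed equation; the inequality then bounds the square of d. *)
  have "(- d) \<bullet> zs \<ge> (\<Sum>i\<in>UNIV. A (\<iota> i) *v ((- d) $ i)) \<bullet> vs"
    using ineq[OF u, of "z - d"]
    by (simp add: v matrix_vector_mult_diff_distrib sum_subtractf inner_diff_left
        linear_neg[OF matrix_vector_mul_linear] sum_negf)
  then have "d \<bullet> zs \<le> (\<Sum>i\<in>UNIV. A (\<iota> i) *v (d $ i)) \<bullet> vs"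
    by (simp add: linear_neg[OF matrix_vector_mul_linear] sum_negf)
  moreover have "(\<Sum>i\<in>UNIV. A (\<iota> i) *v (d $ i)) \<bullet> vs = (\<Sum>i\<in>UNIV. d $ i \<bullet> (transpose (A (\<iota> i)) *v vs))"
    by (simp add: inner_sum_left inner_transpose_mult_vector del: transpose_matrix_vector)
  moreover have "d \<bullet> d = d \<bullet> zs - (\<Sum>i\<in>UNIV. d $ i \<bullet> (transpose (A (\<iota> i)) *v vs))"
    unfolding inner_vec_def[of d d] inner_vec_def[of d zs]
    by (simp add: d_def inner_diff_right sum_subtractf del: transpose_matrix_vector)
  ultimately have "d \<bullet> d \<le> 0" by simp
  then have "d = 0" by (metis inner_eq_zero_iff inner_ge_zero order_antisym)
  then have "d $ i = 0" by simp
  then show "zs $ i = transpose (A (\<iota> i)) *v vs" by (simp add: d_def)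
qed

lemma sum_pack:
  assumes "bij_betw \<iota> (UNIV :: 'k::finite set) {..<\<kappa>}"
  shows "(\<Sum>i\<in>UNIV. f (\<iota> i)) = (\<Sum>j<\<kappa>. f j)"
  using sum.reindex_bij_betw[OF assms] .

lemma inner_pack:
  assumes "bij_betw \<iota> (UNIV :: 'k::finite set) {..<\<kappa>}"
  shows "(pack \<iota> a :: real^'n^'k) \<bullet> pack \<iota> b = (\<Sum>j<\<kappa>. a j \<bullet> b j)"
  using sum_pack[OF assms, of "\<lambda>j. a j \<bullet> b j"] by (simp add: inner_vec_def pack_def)

text \<open>
  For almost every \<open>t\<close> the value of the control is admissible and generates the derivative of the
  trajectory, so the pointwise description of the locally adjoint mapping applies; the bijection
  \<open>\<iota>\<close> turns components of tuples into indices below \<open>\<kappa>\<close>.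
\<close>
lemma adjoint_inclusion_imp_linear_system:
  fixes A :: "nat \<Rightarrow> real^'n^'n" and \<iota> :: "'k::finite \<Rightarrow> nat"
  assumes \<iota>: "bij_betw \<iota> UNIV {..<\<kappa>}"
    and ctrl: "corresponds_to_control \<kappa> A B U x u"
    and adj: "adjoint_inclusion \<kappa> \<iota> (semilinear \<iota> A B U) x xs \<eta>"
  shows "j < \<kappa> \<Longrightarrow> AE t in lebesgue_on {0..1}.
      (if j = 0 then (-1) ^ \<kappa> *\<^sub>R D \<kappa> xs t else \<eta> (\<kappa> - j) t) + D 1 (\<eta> (\<kappa> - j - 1)) t
        = transpose (A j) *v xs t"
    and "AE t in lebesgue_on {0..1}. \<forall>w\<in>U. (B *v w) \<bullet> xs t \<le> (B *v u t) \<bullet> xs t"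
proof -
  let ?L = "\<lambda>t j. (if j = 0 then (-1) ^ \<kappa> *\<^sub>R D \<kappa> xs t else \<eta> (\<kappa> - j) t) + D 1 (\<eta> (\<kappa> - j - 1)) t"
  have "AE t in lebesgue_on {0..1::real}. t \<in> {0..1}" by (rule AE_lebesgue_onI)
  moreover have "AE t in lebesgue_on {0..1}. D \<kappa> x t = (\<Sum>j<\<kappa>. A j *v D j x t) + B *v u t"
    using ctrl by (simp add: corresponds_to_control_def)
  moreover have "AE t in lebesgue_on {0..1}. pack \<iota> (?L t)
      \<in> locally_adjoint (semilinear \<iota> A B U) (xs t) (pack \<iota> (\<lambda>j. D j x t), D \<kappa> x t)"
    using adj by (simp add: adjoint_inclusion_def)
  ultimately have AE: "AE t in lebesgue_on {0..1}. (\<forall>j<\<kappa>. ?L t j = transpose (A j) *v xs t) \<and>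
      (\<forall>w\<in>U. (B *v w) \<bullet> xs t \<le> (B *v u t) \<bullet> xs t)"
  proof eventually_elim
    case (elim t)
    have ut: "u t \<in> U" using ctrl elim(1) by (simp add: corresponds_to_control_def)
    have v: "D \<kappa> x t = (\<Sum>i\<in>UNIV. A (\<iota> i) *v (pack \<iota> (\<lambda>j. D j x t) $ i)) + B *v u t"
      using elim(2) sum_pack[OF \<iota>, of "\<lambda>j. A j *v D j x t"] by (simp add: pack_def)
    note * = locally_adjoint_semilinear[OF elim(3) ut v]
    have "?L t j = transpose (A j) *v xs t" if "j < \<kappa>" for j
    proof -
      obtain i where "j = \<iota> i" using \<iota> \<open>j < \<kappa>\<close> unfolding bij_betw_def by blast
      then show ?thesis using *(1)[of i] by (simp only: pack_def vec_lambda_beta)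
    qed
    then show ?case using *(2) by blast
  qed
  show "j < \<kappa> \<Longrightarrow> AE t in lebesgue_on {0..1}. ?L t j = transpose (A j) *v xs t"
    using AE by eventually_elim blast
  show "AE t in lebesgue_on {0..1}. \<forall>w\<in>U. (B *v w) \<bullet> xs t \<le> (B *v u t) \<bullet> xs t"
    using AE by eventually_elim blast
qed

text \<open>
  The components with index \<open>j > 0\<close> determine \<open>\<eta>\<^sub>1, \<eta>\<^sub>2, \<dots>\<close> successively from \<open>x\<^sup>*\<close> through the recursion
  that \<open>eta_of\<close> satisfies. The system holds only almost everywhere; continuity gives equality at every
  point, which the end-point conditions need.
\<close>
lemma adjoint_functions_eq_eta_of:
  fixes A :: "nat \<Rightarrow> real^'n^'n"
  assumes xs: "regular \<kappa> xs" and \<eta>: "\<And>j. j \<in> {1..<\<kappa>} \<Longrightarrow> continuous_on {0..1} (\<eta> j)"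
    and \<eta>0: "\<eta> 0 = (\<lambda>t. 0)"
    and adj: "\<And>j. \<lbrakk>0 < j; j < \<kappa>\<rbrakk> \<Longrightarrow> AE t in lebesgue_on {0..1}.
      \<eta> (\<kappa> - j) t + D 1 (\<eta> (\<kappa> - j - 1)) t = transpose (A j) *v xs t"
    and j: "j < \<kappa>" and t: "t \<in> {0..1}"
  shows "\<eta> j t = eta_of \<kappa> A xs j t"
  using j t
proof (induction j arbitrary: t)
  case 0
  then show ?case by (simp add: \<eta>0)
next
  case (Suc j)
  then have j: "j < \<kappa>" "Suc j < \<kappa>" by auto
  have "AE t in lebesgue_on {0..1}.
      \<eta> (\<kappa> - (\<kappa> - Suc j)) t + D 1 (\<eta> (\<kappa> - (\<kappa> - Suc j) - 1)) t = transpose (A (\<kappa> - Suc j)) *v xs t"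
    using j by (intro adj) auto
  moreover have "\<kappa> - (\<kappa> - Suc j) = Suc j" "\<kappa> - (\<kappa> - Suc j) - 1 = j" using j by auto
  ultimately have "AE t in lebesgue_on {0..1}.
      \<eta> (Suc j) t + D 1 (\<eta> j) t = transpose (A (\<kappa> - Suc j)) *v xs t" by (simp only:)
  moreover have "AE t in lebesgue_on {0..1}.
      D 1 (\<eta> j) t = transpose (A (\<kappa> - Suc j)) *v xs t - eta_of \<kappa> A xs (Suc j) t"
    using Suc.IH[OF j(1)] by (intro ac_with_derivative_unique[OF eta_of_ac_with_derivative[OF xs j(1)]])
  ultimately have AE: "AE t in lebesgue_on {0..1}. \<eta> (Suc j) t = eta_of \<kappa> A xs (Suc j) t"
  proof eventually_elim
    case (elim t)
    have "\<eta> (Suc j) t = (\<eta> (Suc j) t + D 1 (\<eta> j) t) - D 1 (\<eta> j) t" by simp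
    also have "\<dots> = eta_of \<kappa> A xs (Suc j) t" unfolding elim(1) unfolding elim(2) by simp
    finally show ?case .
  qed
  have "continuous_on {0..1} (eta_of \<kappa> A xs (Suc j))"
    using eta_of_ac_with_derivative[OF xs j(2)]
    by (auto simp: ac_with_derivative_def intro: abs_continuous_on_imp_continuous_on)
  then show ?case
    using \<eta>[of "Suc j"] j Suc.prems(2) by (intro continuous_on_AE_eq_imp_eq[OF _ _ AE]) auto
qed

text \<open>
  Eliminating the adjoint functions from the component with index 0 leaves the Euler--Lagrange
  equation: the recursion for \<open>eta_of\<close>, continued to the index \<open>\<kappa>\<close>, produces its right-hand side.
\<close>
lemma adjoint_system_imp_euler_lagrange:
  fixes A :: "nat \<Rightarrow> real^'n^'n"
  assumes \<kappa>: "\<kappa> \<ge> 1" and xs: "regular \<kappa> xs"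
    and eq: "\<And>t. t \<in> {0..1} \<Longrightarrow> \<eta> (\<kappa> - 1) t = eta_of \<kappa> A xs (\<kappa> - 1) t"
    and adj: "AE t in lebesgue_on {0..1}.
      (-1) ^ \<kappa> *\<^sub>R D \<kappa> xs t + D 1 (\<eta> (\<kappa> - 1)) t = transpose (A 0) *v xs t"
  shows "xs \<in> euler_lagrange_solutions \<kappa> A"
proof -
  have "AE t in lebesgue_on {0..1}. D 1 (\<eta> (\<kappa> - 1)) t
      = transpose (A (\<kappa> - Suc (\<kappa> - 1))) *v xs t - eta_of \<kappa> A xs (Suc (\<kappa> - 1)) t"
    using \<kappa> by (intro ac_with_derivative_unique[OF eta_of_ac_with_derivative[OF xs] eq]) auto
  with adj have "AE t in lebesgue_on {0..1}. costate \<kappa> A xs \<kappa> t = 0"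
  proof eventually_elim
    case (elim t)
    have "(-1) ^ \<kappa> *\<^sub>R D \<kappa> xs t = ((-1) ^ \<kappa> *\<^sub>R D \<kappa> xs t + D 1 (\<eta> (\<kappa> - 1)) t) - D 1 (\<eta> (\<kappa> - 1)) t"
      by simp
    also have "\<dots> = eta_of \<kappa> A xs \<kappa> t" unfolding elim(1) unfolding elim(2) using \<kappa> by simp
    finally show ?case by (simp add: costate_def)
  qed
  then show ?thesis using xs by (simp add: euler_lagrange_iff_costate)
qed

section \<open>Duality\<close>

text \<open>
  Finite lower bounds exclude \<open>-\<infinity>\<close>, so extended-real sums behave as in real arithmetic, and a sum
  attains the sum of the bounds only if every term attains its own bound.
\<close>
lemma ereal_sum_lower_bound:
  fixes c :: "'i \<Rightarrow> ereal"
  assumes "finite I" "\<And>i. i \<in> I \<Longrightarrow> ereal (c0 i) \<le> c i"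
  shows "ereal (sum c0 I) \<le> sum c I \<and> (sum c I = ereal (sum c0 I) \<longleftrightarrow> (\<forall>i\<in>I. c i = ereal (c0 i)))"
  using assms
proof (induction I rule: finite_induct)
  case empty
  then show ?case by (simp add: zero_ereal_def)
next
  case (insert i I)
  then have "ereal (c0 i) \<le> c i" "ereal (sum c0 I) \<le> sum c I"
    "sum c I = ereal (sum c0 I) \<longleftrightarrow> (\<forall>i\<in>I. c i = ereal (c0 i))" by auto
  then show ?case
    using insert.hyps by (cases "c i"; cases "sum c I") auto
qed

lemma ereal_neg_sum_upper_bound:
  assumes "ereal a0 \<le> a" "ereal b0 \<le> b" "ereal c0 \<le> c"
  shows "- a - b - c \<le> ereal (- a0 - b0 - c0) \<and>
    (- a - b - c = ereal (- a0 - b0 - c0) \<longleftrightarrow> a = ereal a0 \<and> b = ereal b0 \<and> c = ereal c0)"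
  using assms by (cases a; cases b; cases c) auto

lemma endpoint_tuple_eq_pack_costate:
  assumes "bij_betw \<iota> (UNIV :: 'k::finite set) {..<\<kappa>}"
  shows "(endpoint_tuple \<kappa> \<iota> xs (eta_of \<kappa> A xs) :: real^'n^'k)
    = pack \<iota> (\<lambda>j. costate \<kappa> A xs (\<kappa> - Suc j) 1)"
proof -
  have "\<iota> i < \<kappa>" for i using assms by (auto simp: bij_betw_def)
  then have "\<kappa> - \<iota> i = Suc (\<kappa> - Suc (\<iota> i))" for i by (simp add: Suc_diff_Suc)
  then have "(-1) ^ (\<kappa> - \<iota> i) = (-1 :: real) ^ Suc (\<kappa> - Suc (\<iota> i))" for i by metis
  then show ?thesis
    by (simp add: endpoint_tuple_def pack_def costate_def vec_eq_iff)
qed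

lemma initial_transversality_iff_costate:
  assumes "\<kappa> \<ge> 1"
  shows "initial_transversality \<kappa> Q x xs (eta_of \<kappa> A xs) \<longleftrightarrow>
    (\<forall>j<\<kappa>. costate \<kappa> A xs j 0 \<in> dual_cone_at (Q (\<kappa> - j - 1)) (D (\<kappa> - j - 1) x 0))"
    (is "?L \<longleftrightarrow> (\<forall>j<\<kappa>. ?P j)")
proof -
  have split: "(\<forall>j<\<kappa>. P j) \<longleftrightarrow> (\<forall>j\<in>{1..<\<kappa>}. P j) \<and> P 0" for P
  proof
    show "\<forall>j<\<kappa>. P j" if "(\<forall>j\<in>{1..<\<kappa>}. P j) \<and> P 0"
    proof (intro allI impI)
      fix j assume "j < \<kappa>"
      then show "P j" using that by (cases j) auto
    qed
  qed (use assms in auto)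
  show ?thesis
    unfolding split[of ?P] by (simp add: initial_transversality_def costate_def)
qed

text \<open>
  Weak duality with its equality case. Each of the three kinds of terms of the dual objective is
  estimated by testing the supremum in it with the data of the trajectory: the conjugate at the final
  values, the support functions of the \<open>Q j\<close> at the initial values, and the support function of \<open>U\<close>
  at the control, under the integral. By the Lagrange identity the test values add up to the primal
  objective. All test values are finite, so equality in the sum means equality in each
  term, and these equalities are the transversality conditions and the maximum principle.
\<close>
lemma dual_objective_le_primal:
  fixes A :: "nat \<Rightarrow> real^'n^'n" and B :: "real^'r^'n" and \<iota> :: "'k::finite \<Rightarrow> nat"
    and \<phi> :: "real^'n^'k \<Rightarrow> real"
  assumes \<kappa>: "\<kappa> \<ge> 1" and \<iota>: "bij_betw \<iota> UNIV {..<\<kappa>}"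
    and x: "regular \<kappa> x" and x0: "\<And>j. j < \<kappa> \<Longrightarrow> D j x 0 \<in> Q j"
    and ctrl: "corresponds_to_control \<kappa> A B U x u"
    and xs: "xs \<in> euler_lagrange_solutions \<kappa> A"
  shows "dual_objective \<kappa> \<iota> \<phi> A B U Q xs \<le> ereal (primal_objective \<iota> \<phi> x) \<and>
    (dual_objective \<kappa> \<iota> \<phi> A B U Q xs = ereal (primal_objective \<iota> \<phi> x) \<longleftrightarrow>
      initial_transversality \<kappa> Q x xs (eta_of \<kappa> A xs) \<and>
      final_transversality \<kappa> \<iota> \<phi> x xs (eta_of \<kappa> A xs) \<and>
      (AE t in lebesgue_on {0..1}. ereal ((B *v u t) \<bullet> xs t) = (SUP w \<in> U. ereal ((B *v w) \<bullet> xs t))))"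
proof -
  define p where "p = costate \<kappa> A xs"
  define H where "H t = (\<Sum>j<\<kappa>. D (\<kappa> - Suc j) x t \<bullet> p j t)" for t
  define X where "X = (pack \<iota> (\<lambda>j. D j x 1) :: real^'n^'k)"
  define e where "e = (endpoint_tuple \<kappa> \<iota> xs (eta_of \<kappa> A xs) :: real^'n^'k)"
  (* The control need not be measurable, but B u is, being almost everywhere the residual of the
     differential equation; the integrable minorant r is therefore written with the residual. *)
  define r where "r t = (D \<kappa> x t - (\<Sum>j<\<kappa>. A j *v D j x t)) \<bullet> xs t" for t
  define W where "W t = support_fun U (transpose B *v xs t)" for t
  define c where "c j = support_fun (Q (\<kappa> - j - 1)) (- p j 0)" for j
  define c0 where "c0 j = - (D (\<kappa> - j - 1) x 0 \<bullet> p j 0)" for j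
  have reg: "regular \<kappa> xs" using xs by (simp add: euler_lagrange_solutions_def)
  have cont: "continuous_on {0..1} xs" using regular_continuous_on[OF reg, of 0] \<kappa> by simp

  have Xe: "X \<bullet> e = H 1"
    unfolding X_def e_def endpoint_tuple_eq_pack_costate[OF \<iota>] inner_pack[OF \<iota>] H_def p_def
    by (subst sum.nat_diff_reindex[symmetric]) (auto intro!: sum.cong)
  have conj_ge: "ereal (H 1 - \<phi> X) \<le> conjugate_fun \<phi> e"
    using conjugate_fun_ge[of X e \<phi>] by (simp add: Xe)
  have conj_eq: "conjugate_fun \<phi> e = ereal (H 1 - \<phi> X) \<longleftrightarrow>
      final_transversality \<kappa> \<iota> \<phi> x xs (eta_of \<kappa> A xs)"
    unfolding final_transversality_def X_def[symmetric] e_def[symmetric]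
    by (simp add: subdifferential_iff_conjugate Xe)

  have r: "integrable (lebesgue_on {0..1}) r"
    unfolding r_def by (rule integrable_residual_inner[OF x cont])
  have r_int: "(r has_integral H 0 - H 1) {0..1}"
    using lagrange_identity[OF x xs] by (simp add: r_def[abs_def] H_def p_def)
  have int_r: "integral\<^sup>L (lebesgue_on {0..1}) r = H 0 - H 1"
    by (rule has_integral_unique[OF has_integral_integral_lebesgue_on[OF r] r_int]) simp
  have W_SUP: "W t = (SUP w \<in> U. ereal ((B *v w) \<bullet> xs t))" for t
    by (simp add: W_def support_fun_def inner_transpose_mult_vector del: transpose_matrix_vector)
  have r_eq: "AE t in lebesgue_on {0..1}. r t = (B *v u t) \<bullet> xs t"
  proof -
    have "AE t in lebesgue_on {0..1}. D \<kappa> x t = (\<Sum>j<\<kappa>. A j *v D j x t) + B *v u t"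
      using ctrl by (simp add: corresponds_to_control_def)
    then show ?thesis by eventually_elim (simp add: r_def)
  qed
  have rW: "AE t in lebesgue_on {0..1}. ereal (r t) \<le> W t"
  proof -
    have "AE t in lebesgue_on {0..1::real}. t \<in> {0..1}" by (rule AE_lebesgue_onI)
    with r_eq show ?thesis
    proof eventually_elim
      case (elim t)
      then have "u t \<in> U" using ctrl by (simp add: corresponds_to_control_def)
      then show ?case unfolding W_SUP elim(1) by (rule SUP_upper)
    qed
  qed
  have int_ge: "ereal (H 0 - H 1) \<le> ereal_integral (lebesgue_on {0..1}) W"
    using ereal_integral_ge[OF r rW] by (simp add: int_r)
  have W_meas: "W \<in> borel_measurable (lebesgue_on {0..1})"
    unfolding W_def
    by (intro borel_measurable_support_fun
        bounded_linear.continuous_on[OF matrix_vector_mul_bounded_linear] cont) simp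
  have int_eq: "ereal_integral (lebesgue_on {0..1}) W = ereal (H 0 - H 1) \<longleftrightarrow>
      (AE t in lebesgue_on {0..1}. ereal ((B *v u t) \<bullet> xs t) = (SUP w \<in> U. ereal ((B *v w) \<bullet> xs t)))"
    (is "?E \<longleftrightarrow> ?M")
  proof
    assume ?E
    then have "AE t in lebesgue_on {0..1}. W t = ereal (r t)"
      using ereal_integral_eq_imp_AE[OF r rW W_meas] by (simp add: int_r)
    with r_eq show ?M by eventually_elim (simp add: W_SUP)
  next
    assume ?M
    with r_eq have "AE t in lebesgue_on {0..1}. W t = ereal (r t)"
      by eventually_elim (simp add: W_SUP)
    from ereal_integral_cong_AE[OF r this] show ?E by (simp add: int_r)
  qed

  have mem: "D (\<kappa> - j - 1) x 0 \<in> Q (\<kappa> - j - 1)" if "j < \<kappa>" for j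
    using x0[of "\<kappa> - j - 1"] that by simp
  have c_ge: "ereal (c0 j) \<le> c j" if "j < \<kappa>" for j
    using support_fun_ge[OF mem[OF that], of "- p j 0"] by (simp add: c_def c0_def)
  have c_eq: "c j = ereal (c0 j) \<longleftrightarrow> p j 0 \<in> dual_cone_at (Q (\<kappa> - j - 1)) (D (\<kappa> - j - 1) x 0)"
    if "j < \<kappa>" for j
    using dual_cone_at_iff_support[OF mem[OF that], of "- p j 0"] by (simp add: c_def c0_def)
  have sum_c0: "sum c0 {..<\<kappa>} = - H 0"
    by (simp add: c0_def H_def sum_negf)
  have sum_c: "ereal (- H 0) \<le> sum c {..<\<kappa>}"
    "sum c {..<\<kappa>} = ereal (- H 0) \<longleftrightarrow> initial_transversality \<kappa> Q x xs (eta_of \<kappa> A xs)"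
    using ereal_sum_lower_bound[of "{..<\<kappa>}" c0 c] c_ge c_eq
    unfolding sum_c0 initial_transversality_iff_costate[OF \<kappa>] p_def[symmetric] by auto

  have "dual_objective \<kappa> \<iota> \<phi> A B U Q xs
      = - conjugate_fun \<phi> e - ereal_integral (lebesgue_on {0..1}) W - sum c {..<\<kappa>}"
    by (simp add: dual_objective_def e_def W_def[abs_def] c_def p_def costate_def)
  moreover have "primal_objective \<iota> \<phi> x = - (H 1 - \<phi> X) - (H 0 - H 1) - (- H 0)"
    by (simp add: primal_objective_def X_def)
  ultimately show ?thesis
    using ereal_neg_sum_upper_bound[OF conj_ge int_ge sum_c(1)]
    unfolding conj_eq int_eq sum_c(2) by (simp only: conj_ac)
qed

text \<open>
  Shows that equality in weak duality occurs: the adjoint trajectory of the sufficient conditions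
  meets every condition of the equality case.
\<close>
lemma sufficient_conditions_imp_dual_optimality_conditions:
  fixes A :: "nat \<Rightarrow> real^'n^'n" and B :: "real^'r^'n" and \<iota> :: "'k::finite \<Rightarrow> nat"
  assumes \<kappa>: "\<kappa> \<ge> 1" and \<iota>: "bij_betw \<iota> UNIV {..<\<kappa>}"
    and ctrl: "corresponds_to_control \<kappa> A B U x u"
    and suff: "sufficient_conditions \<kappa> \<iota> \<phi> (semilinear \<iota> A B U) Q x xs \<eta>"
  shows "xs \<in> euler_lagrange_solutions \<kappa> A"
    and "initial_transversality \<kappa> Q x xs (eta_of \<kappa> A xs)"
    and "final_transversality \<kappa> \<iota> \<phi> x xs (eta_of \<kappa> A xs)"
    and "AE t in lebesgue_on {0..1}. ereal ((B *v u t) \<bullet> xs t) = (SUP w \<in> U. ereal ((B *v w) \<bullet> xs t))"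
proof -
  have reg: "regular \<kappa> xs" and \<eta>: "\<And>j. j \<in> {1..<\<kappa>} \<Longrightarrow> regular 1 (\<eta> j)" and \<eta>0: "\<eta> 0 = (\<lambda>t. 0)"
    and adj: "adjoint_inclusion \<kappa> \<iota> (semilinear \<iota> A B U) x xs \<eta>"
    and init: "initial_transversality \<kappa> Q x xs \<eta>"
    and final: "final_transversality \<kappa> \<iota> \<phi> x xs \<eta>"
    using suff by (simp_all add: sufficient_conditions_def)
  note sys = adjoint_inclusion_imp_linear_system[OF \<iota> ctrl adj]
  have eq: "\<eta> j t = eta_of \<kappa> A xs j t" if "j < \<kappa>" "t \<in> {0..1}" for j t
  proof (rule adjoint_functions_eq_eta_of[where \<eta>=\<eta>, OF reg _ \<eta>0 _ that])
    show "continuous_on {0..1} (\<eta> j)" if "j \<in> {1..<\<kappa>}" for j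
      using regular_continuous_on[OF \<eta>[OF that], of 0] by simp
    show "AE t in lebesgue_on {0..1}. \<eta> (\<kappa> - j) t + D 1 (\<eta> (\<kappa> - j - 1)) t = transpose (A j) *v xs t"
      if "0 < j" "j < \<kappa>" for j
      using sys(1)[OF that(2)] that(1) by simp
  qed
  show "xs \<in> euler_lagrange_solutions \<kappa> A"
  proof (rule adjoint_system_imp_euler_lagrange[where \<eta>=\<eta>, OF \<kappa> reg])
    show "\<eta> (\<kappa> - 1) t = eta_of \<kappa> A xs (\<kappa> - 1) t" if "t \<in> {0..1}" for t
      using eq[OF _ that] \<kappa> by simp
    show "AE t in lebesgue_on {0..1}.
        (-1) ^ \<kappa> *\<^sub>R D \<kappa> xs t + D 1 (\<eta> (\<kappa> - 1)) t = transpose (A 0) *v xs t"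
      using sys(1)[of 0] \<kappa> by simp
  qed
  show "initial_transversality \<kappa> Q x xs (eta_of \<kappa> A xs)"
    using init eq[of _ 0] by (auto simp: initial_transversality_def)
  have "endpoint_tuple \<kappa> \<iota> xs \<eta> = endpoint_tuple \<kappa> \<iota> xs (eta_of \<kappa> A xs)"
    using eq[of _ 1] \<kappa> by (simp add: endpoint_tuple_def pack_def vec_eq_iff)
  then show "final_transversality \<kappa> \<iota> \<phi> x xs (eta_of \<kappa> A xs)"
    using final by (simp add: final_transversality_def)
  have "AE t in lebesgue_on {0..1::real}. t \<in> {0..1}" by (rule AE_lebesgue_onI)
  with sys(2) show "AE t in lebesgue_on {0..1}.
      ereal ((B *v u t) \<bullet> xs t) = (SUP w \<in> U. ereal ((B *v w) \<bullet> xs t))"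
  proof eventually_elim
    case (elim t)
    then have "u t \<in> U" using ctrl by (simp add: corresponds_to_control_def)
    then show ?case
      using elim(1) by (intro antisym SUP_upper SUP_least) auto
  qed
qed

theorem theorem4p2:
  fixes \<kappa> :: nat and \<iota> :: "'k::finite \<Rightarrow> nat"
    and A :: "nat \<Rightarrow> real^'n^'n" and B :: "real^'r^'n" and U :: "(real^'r) set"
    and \<phi> :: "real^'n^'k \<Rightarrow> real" and Q :: "nat \<Rightarrow> (real^'n) set"
    and xt :: "real \<Rightarrow> real^'n" and ut :: "real \<Rightarrow> real^'r"
  assumes "\<kappa> \<ge> 1" and "bij_betw \<iota> UNIV {..<\<kappa>}"
    and "convex U"
    and "continuous_on UNIV \<phi>" and "convex_on UNIV \<phi>"
    and "\<forall>j<\<kappa>. convex (Q j)"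
    and "primal_optimal \<kappa> \<iota> \<phi> (semilinear \<iota> A B U) Q xt"
    and "corresponds_to_control \<kappa> A B U xt ut"
    and "\<exists>xs \<eta>. sufficient_conditions \<kappa> \<iota> \<phi> (semilinear \<iota> A B U) Q xt xs \<eta>"
  shows "(\<forall>xd. dual_optimal \<kappa> \<iota> \<phi> A B U Q xd \<longleftrightarrow>
            xd \<in> euler_lagrange_solutions \<kappa> A \<and>
            initial_transversality \<kappa> Q xt xd (eta_of \<kappa> A xd) \<and>
            final_transversality \<kappa> \<iota> \<phi> xt xd (eta_of \<kappa> A xd) \<and>
            (AE t in lebesgue_on {0..1}.
               ereal ((B *v ut t) \<bullet> xd t) = (SUP u \<in> U. ereal ((B *v u) \<bullet> xd t)))) \<and>
         primal_value \<kappa> \<iota> \<phi> (semilinear \<iota> A B U) Q = dual_value \<kappa> \<iota> \<phi> A B U Q"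
proof -
  let ?EL = "euler_lagrange_solutions \<kappa> A"
  let ?dual = "dual_objective \<kappa> \<iota> \<phi> A B U Q" and ?p = "ereal (primal_objective \<iota> \<phi> xt)"
  have feas: "xt \<in> primal_feasible \<kappa> \<iota> (semilinear \<iota> A B U) Q"
    and opt: "\<And>y. y \<in> primal_feasible \<kappa> \<iota> (semilinear \<iota> A B U) Q
      \<Longrightarrow> primal_objective \<iota> \<phi> xt \<le> primal_objective \<iota> \<phi> y"
    using assms(7) by (simp_all add: primal_optimal_def)
  have reg: "regular \<kappa> xt" and xt0: "\<And>j. j < \<kappa> \<Longrightarrow> D j xt 0 \<in> Q j"
    using feas by (simp_all add: primal_feasible_def)
  note duality = dual_objective_le_primal[where \<phi>=\<phi>, OF assms(1,2) reg xt0 assms(8)]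
  obtain xs \<eta> where "sufficient_conditions \<kappa> \<iota> \<phi> (semilinear \<iota> A B U) Q xt xs \<eta>"
    using assms(9) by blast
  note cond = sufficient_conditions_imp_dual_optimality_conditions[OF assms(1,2,8) this]
  have xs: "?dual xs = ?p" using duality[OF _ cond(1)] cond(2-4) by blast
  have dual_optimal: "dual_optimal \<kappa> \<iota> \<phi> A B U Q xd \<longleftrightarrow> xd \<in> ?EL \<and> ?dual xd = ?p" for xd
  proof
    assume "dual_optimal \<kappa> \<iota> \<phi> A B U Q xd"
    then have "xd \<in> ?EL" "?dual xs \<le> ?dual xd" using cond(1) by (auto simp: dual_optimal_def)
    then show "xd \<in> ?EL \<and> ?dual xd = ?p" using duality[of xd] xs by (metis antisym)
  next
    assume "xd \<in> ?EL \<and> ?dual xd = ?p"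
    then show "dual_optimal \<kappa> \<iota> \<phi> A B U Q xd"
      using duality by (simp add: dual_optimal_def)
  qed
  have "primal_value \<kappa> \<iota> \<phi> (semilinear \<iota> A B U) Q = ?p"
    unfolding primal_value_def using feas opt by (intro antisym INF_lower INF_greatest) auto
  moreover have "dual_value \<kappa> \<iota> \<phi> A B U Q = ?p"
    unfolding dual_value_def
  proof (rule antisym)
    show "(SUP xd \<in> ?EL. ?dual xd) \<le> ?p" using duality by (intro SUP_least) simp
    show "?p \<le> (SUP xd \<in> ?EL. ?dual xd)" using SUP_upper[OF cond(1), of ?dual] by (simp add: xs)
  qed
  ultimately have value_eq: "primal_value \<kappa> \<iota> \<phi> (semilinear \<iota> A B U) Q = dual_value \<kappa> \<iota> \<phi> A B U Q"
    by (simp only:)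
  show ?thesis
    unfolding dual_optimal by (intro conjI allI value_eq conj_cong refl) (rule conjunct2[OF duality])
qed

end
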